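(* Let $M$ be a monoid and $C : \mathbf{PSh}(M) \to \mathbf{Set}$ the connected components functor. The following are equivalent: (1) $C$ preserves finite limits, i.e. $\mathbf{PSh}(M)$ is totally connected, i.e. the terminal left $M$-set $1$ is flat. (2) $M$ is cofiltered as a category. (3) $M$ is right collapsible. (4) $C$ preserves pullbacks. (5) $C$ preserves equalizers. (6) The category of points of $\mathbf{PSh}(M)$ has a terminal object.
   Context: For a monoid $M$, $\mathbf{PSh}(M)$ denotes the category of right $M$-sets (the empty one included) and $M$-equivariant maps. $C : \mathbf{PSh}(M) \to \mathbf{Set}$ sends $X$ to the quotient of $X$ by the equivalence relation generated by $x \sim xm$ ($x\in X$, $m \in M$), i.e. $C(X) \cong X \otimes_M 1$ with $1$ the terminal left $M$-set; it is left adjoint to the functor $\mathbf{Set} \to \mathbf{PSh}(M)$ equipping a set with the trivial action. $\mathbf{PSh}(M)$ is called totally connected if $C$ preserves finite limits. A left $M$-set $B$ is flat if $-\otimes_M B : \mathbf{PSh}(M) \to \mathbf{Set}$ preserves finite limits. $M$ is viewed as a one-object category; a category is cofiltered if its opposite is filtered. $M$ is right collapsible if for all $m_1,m_2 \in M$ there exists $m \in M$ with $m_1m = m_2m$. The category of points of $\mathbf{PSh}(M)$ has as objects the geometric morphisms $\mathbf{Set} \to \mathbf{PSh}(M)$ and as morphisms the natural transformations between inverse image functors; it is equivalent to the category of flat left $M$-sets and left $M$-set homomorphisms. *)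

theory Defs
  imports "HOL-Algebra.Group" "HOL-Library.Equipollence"
begin

section \<open>Categories, functors, finite limits, adjunctions\<close>

text \<open>
  An arrow need not determine its source and target (a function in \<open>X \<rightarrow>\<^sub>E Y\<close> does not
  determine \<open>Y\<close>), so composition and the arrow part of a functor take the objects as
  arguments: for \<open>f : X \<rightarrow> Y\<close> and \<open>g : Y \<rightarrow> Z\<close>, \<open>Comp C X Y Z g f\<close> is \<open>g \<circ> f\<close>, and
  \<open>fmap F X Y f : F X \<rightarrow> F Y\<close>.
\<close>

record ('o, 'a) cat =
  Ob :: "'o set"
  Arr :: "'o \<Rightarrow> 'o \<Rightarrow> 'a set"
  Idt :: "'o \<Rightarrow> 'a"
  Comp :: "'o \<Rightarrow> 'o \<Rightarrow> 'o \<Rightarrow> 'a \<Rightarrow> 'a \<Rightarrow> 'a"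

definition is_category :: "('o, 'a) cat \<Rightarrow> bool" where
  "is_category C \<longleftrightarrow>
     (\<forall>X\<in>Ob C. Idt C X \<in> Arr C X X) \<and>
     (\<forall>X\<in>Ob C. \<forall>Y\<in>Ob C. \<forall>Z\<in>Ob C. \<forall>f\<in>Arr C X Y. \<forall>g\<in>Arr C Y Z.
        Comp C X Y Z g f \<in> Arr C X Z) \<and>
     (\<forall>X\<in>Ob C. \<forall>Y\<in>Ob C. \<forall>f\<in>Arr C X Y.
        Comp C X X Y f (Idt C X) = f \<and> Comp C X Y Y (Idt C Y) f = f) \<and>
     (\<forall>W\<in>Ob C. \<forall>X\<in>Ob C. \<forall>Y\<in>Ob C. \<forall>Z\<in>Ob C.
        \<forall>f\<in>Arr C W X. \<forall>g\<in>Arr C X Y. \<forall>h\<in>Arr C Y Z.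
        Comp C W X Z (Comp C X Y Z h g) f = Comp C W Y Z h (Comp C W X Y g f))"

definition opposite :: "('o, 'a) cat \<Rightarrow> ('o, 'a) cat" where
  "opposite C = \<lparr> Ob = Ob C, Arr = (\<lambda>X Y. Arr C Y X), Idt = Idt C,
                  Comp = (\<lambda>X Y Z g f. Comp C Z Y X f g) \<rparr>"

definition filtered :: "('o, 'a) cat \<Rightarrow> bool" where
  "filtered C \<longleftrightarrow>
     Ob C \<noteq> {} \<and>
     (\<forall>X\<in>Ob C. \<forall>Y\<in>Ob C. \<exists>Z\<in>Ob C. Arr C X Z \<noteq> {} \<and> Arr C Y Z \<noteq> {}) \<and>
     (\<forall>X\<in>Ob C. \<forall>Y\<in>Ob C. \<forall>f\<in>Arr C X Y. \<forall>g\<in>Arr C X Y.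
        \<exists>Z\<in>Ob C. \<exists>h\<in>Arr C Y Z. Comp C X Y Z h f = Comp C X Y Z h g)"

definition cofiltered :: "('o, 'a) cat \<Rightarrow> bool" where
  "cofiltered C \<longleftrightarrow> filtered (opposite C)"

definition has_terminal_object :: "('o, 'a) cat \<Rightarrow> bool" where
  "has_terminal_object C \<longleftrightarrow> (\<exists>T\<in>Ob C. \<forall>X\<in>Ob C. \<exists>!f. f \<in> Arr C X T)"

record ('o1, 'a1, 'o2, 'a2) ftor =
  fobj :: "'o1 \<Rightarrow> 'o2"
  fmap :: "'o1 \<Rightarrow> 'o1 \<Rightarrow> 'a1 \<Rightarrow> 'a2"

definition is_functor ::
  "('o1, 'a1) cat \<Rightarrow> ('o2, 'a2) cat \<Rightarrow> ('o1, 'a1, 'o2, 'a2) ftor \<Rightarrow> bool" where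
  "is_functor C D F \<longleftrightarrow>
     (\<forall>X\<in>Ob C. fobj F X \<in> Ob D) \<and>
     (\<forall>X\<in>Ob C. \<forall>Y\<in>Ob C. \<forall>f\<in>Arr C X Y. fmap F X Y f \<in> Arr D (fobj F X) (fobj F Y)) \<and>
     (\<forall>X\<in>Ob C. fmap F X X (Idt C X) = Idt D (fobj F X)) \<and>
     (\<forall>X\<in>Ob C. \<forall>Y\<in>Ob C. \<forall>Z\<in>Ob C. \<forall>f\<in>Arr C X Y. \<forall>g\<in>Arr C Y Z.
        fmap F X Z (Comp C X Y Z g f) =
        Comp D (fobj F X) (fobj F Y) (fobj F Z) (fmap F Y Z g) (fmap F X Y f))"

definition comp_functor ::
  "('o2, 'a2, 'o3, 'a3) ftor \<Rightarrow> ('o1, 'a1, 'o2, 'a2) ftor \<Rightarrow> ('o1, 'a1, 'o3, 'a3) ftor" where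
  "comp_functor G F = \<lparr> fobj = (\<lambda>X. fobj G (fobj F X)),
                        fmap = (\<lambda>X Y f. fmap G (fobj F X) (fobj F Y) (fmap F X Y f)) \<rparr>"

definition is_cone ::
  "('i, 'b) cat \<Rightarrow> ('o, 'a) cat \<Rightarrow> ('i, 'b, 'o, 'a) ftor \<Rightarrow> 'o \<Rightarrow> ('i \<Rightarrow> 'a) \<Rightarrow> bool" where
  "is_cone J C D L p \<longleftrightarrow>
     L \<in> Ob C \<and>
     (\<forall>i\<in>Ob J. p i \<in> Arr C L (fobj D i)) \<and>
     (\<forall>i\<in>Ob J. \<forall>j\<in>Ob J. \<forall>a\<in>Arr J i j.
        Comp C L (fobj D i) (fobj D j) (fmap D i j a) (p i) = p j)"

definition is_limit ::
  "('i, 'b) cat \<Rightarrow> ('o, 'a) cat \<Rightarrow> ('i, 'b, 'o, 'a) ftor \<Rightarrow> 'o \<Rightarrow> ('i \<Rightarrow> 'a) \<Rightarrow> bool" where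
  "is_limit J C D L p \<longleftrightarrow>
     is_cone J C D L p \<and>
     (\<forall>X q. is_cone J C D X q \<longrightarrow>
        (\<exists>!u. u \<in> Arr C X L \<and> (\<forall>i\<in>Ob J. Comp C X L (fobj D i) (p i) u = q i)))"

text \<open>Every finite category is isomorphic to one whose objects and arrows are natural numbers.\<close>

definition preserves_finite_limits ::
  "('o1, 'a1) cat \<Rightarrow> ('o2, 'a2) cat \<Rightarrow> ('o1, 'a1, 'o2, 'a2) ftor \<Rightarrow> bool" where
  "preserves_finite_limits C D F \<longleftrightarrow>
     (\<forall>(J :: (nat, nat) cat) E L p.
        is_category J \<and> finite (Ob J) \<and> (\<forall>i\<in>Ob J. \<forall>j\<in>Ob J. finite (Arr J i j)) \<and>
        is_functor J C E \<and> is_limit J C E L p \<longrightarrow>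
        is_limit J D (comp_functor F E) (fobj F L)
          (\<lambda>i. fmap F L (fobj E i) (p i)))"

definition is_pullback ::
  "('o, 'a) cat \<Rightarrow> 'o \<Rightarrow> 'o \<Rightarrow> 'o \<Rightarrow> 'a \<Rightarrow> 'a \<Rightarrow> 'o \<Rightarrow> 'a \<Rightarrow> 'a \<Rightarrow> bool" where
  "is_pullback C X Y Z f g P p q \<longleftrightarrow>
     X \<in> Ob C \<and> Y \<in> Ob C \<and> Z \<in> Ob C \<and> P \<in> Ob C \<and>
     f \<in> Arr C X Z \<and> g \<in> Arr C Y Z \<and> p \<in> Arr C P X \<and> q \<in> Arr C P Y \<and>
     Comp C P X Z f p = Comp C P Y Z g q \<and>
     (\<forall>W\<in>Ob C. \<forall>r\<in>Arr C W X. \<forall>s\<in>Arr C W Y.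
        Comp C W X Z f r = Comp C W Y Z g s \<longrightarrow>
        (\<exists>!u. u \<in> Arr C W P \<and> Comp C W P X p u = r \<and> Comp C W P Y q u = s))"

definition preserves_pullbacks ::
  "('o1, 'a1) cat \<Rightarrow> ('o2, 'a2) cat \<Rightarrow> ('o1, 'a1, 'o2, 'a2) ftor \<Rightarrow> bool" where
  "preserves_pullbacks C D F \<longleftrightarrow>
     (\<forall>X Y Z f g P p q. is_pullback C X Y Z f g P p q \<longrightarrow>
        is_pullback D (fobj F X) (fobj F Y) (fobj F Z) (fmap F X Z f) (fmap F Y Z g)
          (fobj F P) (fmap F P X p) (fmap F P Y q))"

definition is_equalizer ::
  "('o, 'a) cat \<Rightarrow> 'o \<Rightarrow> 'o \<Rightarrow> 'a \<Rightarrow> 'a \<Rightarrow> 'o \<Rightarrow> 'a \<Rightarrow> bool" where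
  "is_equalizer C X Y f g E e \<longleftrightarrow>
     X \<in> Ob C \<and> Y \<in> Ob C \<and> E \<in> Ob C \<and>
     f \<in> Arr C X Y \<and> g \<in> Arr C X Y \<and> e \<in> Arr C E X \<and>
     Comp C E X Y f e = Comp C E X Y g e \<and>
     (\<forall>W\<in>Ob C. \<forall>r\<in>Arr C W X.
        Comp C W X Y f r = Comp C W X Y g r \<longrightarrow>
        (\<exists>!u. u \<in> Arr C W E \<and> Comp C W E X e u = r))"

definition preserves_equalizers ::
  "('o1, 'a1) cat \<Rightarrow> ('o2, 'a2) cat \<Rightarrow> ('o1, 'a1, 'o2, 'a2) ftor \<Rightarrow> bool" where
  "preserves_equalizers C D F \<longleftrightarrow>
     (\<forall>X Y f g E e. is_equalizer C X Y f g E e \<longrightarrow>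
        is_equalizer D (fobj F X) (fobj F Y) (fmap F X Y f) (fmap F X Y g)
          (fobj F E) (fmap F E X e))"

text \<open>\<open>left_adjoint C D F G\<close> states that \<open>F : C \<rightarrow> D\<close> is left adjoint to \<open>G : D \<rightarrow> C\<close>.\<close>

definition left_adjoint ::
  "('o1, 'a1) cat \<Rightarrow> ('o2, 'a2) cat \<Rightarrow> ('o1, 'a1, 'o2, 'a2) ftor \<Rightarrow>
   ('o2, 'a2, 'o1, 'a1) ftor \<Rightarrow> bool" where
  "left_adjoint C D F G \<longleftrightarrow>
     is_functor C D F \<and> is_functor D C G \<and>
     (\<exists>\<phi>. (\<forall>X\<in>Ob C. \<forall>Y\<in>Ob D. bij_betw (\<phi> X Y) (Arr D (fobj F X) Y) (Arr C X (fobj G Y))) \<and>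
          (\<forall>X\<in>Ob C. \<forall>X'\<in>Ob C. \<forall>Y\<in>Ob D. \<forall>Y'\<in>Ob D.
             \<forall>h\<in>Arr C X' X. \<forall>g\<in>Arr D (fobj F X) Y. \<forall>k\<in>Arr D Y Y'.
             \<phi> X' Y' (Comp D (fobj F X') Y Y' k
                        (Comp D (fobj F X') (fobj F X) Y g (fmap F X' X h))) =
             Comp C X' (fobj G Y) (fobj G Y') (fmap G Y Y' k)
               (Comp C X' X (fobj G Y) (\<phi> X Y g) h)))"

text \<open>
  The components of a natural transformation are constrained to be \<open>extensional\<close> so that two
  natural transformations are equal as soon as their components at all objects agree.
\<close>

definition nat_trans ::
  "('o1, 'a1) cat \<Rightarrow> ('o2, 'a2) cat \<Rightarrow> ('o1, 'a1, 'o2, 'a2) ftor \<Rightarrow>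
   ('o1, 'a1, 'o2, 'a2) ftor \<Rightarrow> ('o1 \<Rightarrow> 'a2) set" where
  "nat_trans C D F G =
     {\<alpha> \<in> extensional (Ob C).
        (\<forall>X\<in>Ob C. \<alpha> X \<in> Arr D (fobj F X) (fobj G X)) \<and>
        (\<forall>X\<in>Ob C. \<forall>Y\<in>Ob C. \<forall>f\<in>Arr C X Y.
           Comp D (fobj F X) (fobj F Y) (fobj G Y) (\<alpha> Y) (fmap F X Y f) =
           Comp D (fobj F X) (fobj G X) (fobj G Y) (fmap G X Y f) (\<alpha> X))}"

section \<open>Small sets\<close>

text \<open>
  HOL cannot quantify over all sets of all types inside a formula, so, as with a Grothendieck
  universe, ``set'' means small set: \<open>U\<close> says which subsets of a type \<open>'u\<close> are small, and a set
  of any type is small if it is equipollent to one of those. \<open>set_universe M U\<close> collects closure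
  properties that hold for every uncountable Grothendieck universe containing \<open>M\<close>. It requires
  closure under \<open>M\<close>-fold powers only, not under all exponentials: HOL does not
  prove that any infinite \<open>M\<close> has an instance of the latter, whereas these properties have an
  instance for every monoid (\<open>set_universe_exists\<close>).
\<close>

definition is_small :: "('u set \<Rightarrow> bool) \<Rightarrow> 'a set \<Rightarrow> bool" where
  "is_small U A \<longleftrightarrow> (\<exists>B. U B \<and> A \<approx> B)"

definition set_universe :: "('m, 'e) monoid_scheme \<Rightarrow> ('u set \<Rightarrow> bool) \<Rightarrow> bool" where
  "set_universe M U \<longleftrightarrow>
     infinite (UNIV :: 'u set) \<and>
     (\<forall>A. finite A \<longrightarrow> U A) \<and>
     (\<forall>A B. U A \<and> B \<lesssim> A \<longrightarrow> U B) \<and>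
     (\<forall>A B. U A \<and> U B \<longrightarrow> is_small U (A \<times> B)) \<and>
     is_small U (carrier M) \<and>
     (\<forall>A. U A \<longrightarrow> is_small U (carrier M \<rightarrow>\<^sub>E A))"

definition set_cat :: "('u set \<Rightarrow> bool) \<Rightarrow> ('a set, 'a \<Rightarrow> 'a) cat" where
  "set_cat U = \<lparr> Ob = {X. is_small U X}, Arr = (\<lambda>X Y. X \<rightarrow>\<^sub>E Y), Idt = (\<lambda>X. \<lambda>x\<in>X. x),
                 Comp = (\<lambda>X Y Z g f. compose X g f) \<rparr>"

section \<open>Actions of a monoid\<close>

text \<open>
  The values of an action outside the carriers are irrelevant; right \<open>M\<close>-sets that differ only
  there are isomorphic.
\<close>

record ('x, 'm) rset =
  rcar :: "'x set"
  ract :: "'x \<Rightarrow> 'm \<Rightarrow> 'x"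

definition right_mset :: "('m, 'e) monoid_scheme \<Rightarrow> ('x, 'm) rset \<Rightarrow> bool" where
  "right_mset M X \<longleftrightarrow>
     (\<forall>x\<in>rcar X. \<forall>m\<in>carrier M. ract X x m \<in> rcar X) \<and>
     (\<forall>x\<in>rcar X. ract X x \<one>\<^bsub>M\<^esub> = x) \<and>
     (\<forall>x\<in>rcar X. \<forall>m\<in>carrier M. \<forall>n\<in>carrier M. ract X (ract X x m) n = ract X x (m \<otimes>\<^bsub>M\<^esub> n))"

record ('x, 'm) lset =
  lcar :: "'x set"
  lact :: "'m \<Rightarrow> 'x \<Rightarrow> 'x"

definition left_mset :: "('m, 'e) monoid_scheme \<Rightarrow> ('x, 'm) lset \<Rightarrow> bool" where
  "left_mset M B \<longleftrightarrow>
     (\<forall>b\<in>lcar B. \<forall>m\<in>carrier M. lact B m b \<in> lcar B) \<and>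
     (\<forall>b\<in>lcar B. lact B \<one>\<^bsub>M\<^esub> b = b) \<and>
     (\<forall>b\<in>lcar B. \<forall>m\<in>carrier M. \<forall>n\<in>carrier M. lact B m (lact B n b) = lact B (m \<otimes>\<^bsub>M\<^esub> n) b)"

definition terminal_lset :: "(unit, 'm) lset" where
  "terminal_lset = \<lparr> lcar = {()}, lact = (\<lambda>m b. b) \<rparr>"

definition PSh ::
  "('u set \<Rightarrow> bool) \<Rightarrow> ('m, 'e) monoid_scheme \<Rightarrow> (('u, 'm) rset, 'u \<Rightarrow> 'u) cat" where
  "PSh U M =
     \<lparr> Ob = {X. right_mset M X \<and> is_small U (rcar X)},
       Arr = (\<lambda>X Y. {f \<in> rcar X \<rightarrow>\<^sub>E rcar Y.
                       \<forall>x\<in>rcar X. \<forall>m\<in>carrier M. f (ract X x m) = ract Y (f x) m}),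
       Idt = (\<lambda>X. \<lambda>x\<in>rcar X. x),
       Comp = (\<lambda>X Y Z g f. compose (rcar X) g f) \<rparr>"

text \<open>
  In the next two subsections quotients are sets of equivalence classes, and the map induced by \<open>f\<close>
  sends a class \<open>c\<close> to the class of \<open>f x\<close> for any \<open>x \<in> c\<close>, obtained without choice as the
  saturation of the image of \<open>c\<close>.
\<close>

subsection \<open>Connected components\<close>

definition component_rel :: "('m, 'e) monoid_scheme \<Rightarrow> ('u, 'm) rset \<Rightarrow> 'u rel" where
  "component_rel M X =
     {(x, y). equivclp (\<lambda>x y. x \<in> rcar X \<and> (\<exists>m\<in>carrier M. y = ract X x m)) x y}"

definition components ::
  "('m, 'e) monoid_scheme \<Rightarrow> (('u, 'm) rset, 'u \<Rightarrow> 'u, 'u set set, 'u set \<Rightarrow> 'u set) ftor" where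
  "components M =
     \<lparr> fobj = (\<lambda>X. rcar X // component_rel M X),
       fmap = (\<lambda>X Y f. \<lambda>c\<in>rcar X // component_rel M X. component_rel M Y `` (f ` c)) \<rparr>"

definition totally_connected :: "('u set \<Rightarrow> bool) \<Rightarrow> ('m, 'e) monoid_scheme \<Rightarrow> bool" where
  "totally_connected U M \<longleftrightarrow> preserves_finite_limits (PSh U M) (set_cat U) (components M)"

subsection \<open>Tensor products and flatness\<close>

definition tensor_rel ::
  "('m, 'e) monoid_scheme \<Rightarrow> ('b, 'm) lset \<Rightarrow> ('u, 'm) rset \<Rightarrow> ('u \<times> 'b) rel" where
  "tensor_rel M B X =
     {(s, t). equivclp (\<lambda>s t. \<exists>x\<in>rcar X. \<exists>b\<in>lcar B. \<exists>m\<in>carrier M.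
                          s = (ract X x m, b) \<and> t = (x, lact B m b)) s t}"

definition tensor ::
  "('m, 'e) monoid_scheme \<Rightarrow> ('b, 'm) lset \<Rightarrow>
   (('u, 'm) rset, 'u \<Rightarrow> 'u, ('u \<times> 'b) set set, ('u \<times> 'b) set \<Rightarrow> ('u \<times> 'b) set) ftor" where
  "tensor M B =
     \<lparr> fobj = (\<lambda>X. (rcar X \<times> lcar B) // tensor_rel M B X),
       fmap = (\<lambda>X Y f. \<lambda>c\<in>(rcar X \<times> lcar B) // tensor_rel M B X.
                 tensor_rel M B Y `` (map_prod f id ` c)) \<rparr>"

definition flat_lset ::
  "('u set \<Rightarrow> bool) \<Rightarrow> ('m, 'e) monoid_scheme \<Rightarrow> ('b, 'm) lset \<Rightarrow> bool" where
  "flat_lset U M B \<longleftrightarrow>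
     left_mset M B \<and> preserves_finite_limits (PSh U M) (set_cat U) (tensor M B)"

section \<open>Conditions on the monoid\<close>

definition monoid_cat :: "('m, 'e) monoid_scheme \<Rightarrow> (unit, 'm) cat" where
  "monoid_cat M = \<lparr> Ob = {()}, Arr = (\<lambda>_ _. carrier M), Idt = (\<lambda>_. \<one>\<^bsub>M\<^esub>),
                    Comp = (\<lambda>_ _ _ g f. g \<otimes>\<^bsub>M\<^esub> f) \<rparr>"

definition right_collapsible :: "('m, 'e) monoid_scheme \<Rightarrow> bool" where
  "right_collapsible M \<longleftrightarrow>
     (\<forall>m1\<in>carrier M. \<forall>m2\<in>carrier M. \<exists>m\<in>carrier M. m1 \<otimes>\<^bsub>M\<^esub> m = m2 \<otimes>\<^bsub>M\<^esub> m)"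

section \<open>Points\<close>

record ('o1, 'a1, 'o2, 'a2) geom =
  inverse_image :: "('o2, 'a2, 'o1, 'a1) ftor"
  direct_image :: "('o1, 'a1, 'o2, 'a2) ftor"

definition is_geometric_morphism ::
  "('o1, 'a1) cat \<Rightarrow> ('o2, 'a2) cat \<Rightarrow> ('o1, 'a1, 'o2, 'a2) geom \<Rightarrow> bool" where
  "is_geometric_morphism E F h \<longleftrightarrow>
     left_adjoint F E (inverse_image h) (direct_image h) \<and>
     preserves_finite_limits F E (inverse_image h)"

definition points ::
  "('u set \<Rightarrow> bool) \<Rightarrow> ('m, 'e) monoid_scheme \<Rightarrow>
   (('u set, 'u \<Rightarrow> 'u, ('u, 'm) rset, 'u \<Rightarrow> 'u) geom, ('u, 'm) rset \<Rightarrow> 'u \<Rightarrow> 'u) cat" where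
  "points U M =
     \<lparr> Ob = {h. is_geometric_morphism (set_cat U) (PSh U M) h},
       Arr = (\<lambda>h k. nat_trans (PSh U M) (set_cat U) (inverse_image h) (inverse_image k)),
       Idt = (\<lambda>h. \<lambda>X\<in>Ob (PSh U M).
                Idt (set_cat U :: ('u set, 'u \<Rightarrow> 'u) cat) (fobj (inverse_image h) X)),
       Comp = (\<lambda>h k l \<beta> \<alpha>. \<lambda>X\<in>Ob (PSh U M).
                Comp (set_cat U) (fobj (inverse_image h) X) (fobj (inverse_image k) X)
                  (fobj (inverse_image l) X) (\<beta> X) (\<alpha> X)) \<rparr>"

section \<open>Every monoid has a universe\<close>

lemma is_small_UNIV:
  fixes A :: "'a set"
  assumes "inj_on (f :: 'a \<Rightarrow> 'u) A"
  shows "is_small (\<lambda>_ :: 'u set. True) A"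
  using inj_on_imp_bij_betw[OF assms] unfolding is_small_def eqpoll_def by blast

lemma set_universe_exists:
  fixes M :: "('m, 'e) monoid_scheme"
  shows "set_universe M (\<lambda>_ :: ('m option list \<Rightarrow> bool) set. True)"
proof -
  have "infinite (UNIV :: 'm option list set)"
    by (rule infinite_UNIV_listI)
  moreover have "inj (\<lambda>xs ys. ys = (xs :: 'm option list))"
    by (rule injI, drule_tac x = x in fun_cong) simp
  ultimately have 1: "infinite (UNIV :: ('m option list \<Rightarrow> bool) set)"
    using finite_imageD finite_subset top_greatest by blast
  have 2: "is_small (\<lambda>_ :: ('m option list \<Rightarrow> bool) set. True) (A \<times> B)"
    for A B :: "('m option list \<Rightarrow> bool) set"
  proof (rule is_small_UNIV)
    let ?f = "\<lambda>(f, g) xs. case xs of [] \<Rightarrow> False | None # ys \<Rightarrow> f ys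
                 | Some (_ :: 'm) # ys \<Rightarrow> (g ys :: bool)"
    show "inj_on ?f (A \<times> B)"
    proof (rule inj_onI)
      fix p q
      assume eq: "?f p = ?f q"
      have "fst p ys = fst q ys" for ys
        using fun_cong[OF eq, of "None # ys"] by (simp split: prod.splits)
      moreover have "snd p ys = snd q ys" for ys
        using fun_cong[OF eq, of "Some undefined # ys"] by (simp split: prod.splits)
      ultimately show "p = q" by (simp add: prod_eq_iff fun_eq_iff)
    qed
  qed
  have 3: "is_small (\<lambda>_ :: ('m option list \<Rightarrow> bool) set. True) (carrier M)"
    by (rule is_small_UNIV[where f = "\<lambda>m xs. xs = [Some m]"])
       (rule inj_onI, drule_tac x = "[Some x]" in fun_cong, simp)
  have 4: "is_small (\<lambda>_ :: ('m option list \<Rightarrow> bool) set. True) (carrier M \<rightarrow>\<^sub>E A)"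
    for A :: "('m option list \<Rightarrow> bool) set"
  proof (rule is_small_UNIV)
    let ?f = "\<lambda>f xs. case xs of [] \<Rightarrow> False | None # ys \<Rightarrow> False
                 | Some (m :: 'm) # ys \<Rightarrow> (f m ys :: bool)"
    show "inj_on ?f (carrier M \<rightarrow>\<^sub>E A)"
    proof (rule inj_onI)
      fix f g assume eq: "?f f = ?f g"
      have "f m ys = g m ys" for m ys using fun_cong[OF eq, of "Some m # ys"] by simp
      then show "f = g" by blast
    qed
  qed
  show ?thesis unfolding set_universe_def using 1 2 3 4 by simp
qed

end

theory Submission
  imports Defs
begin

text \<open>
  If \<open>M\<close> is right collapsible, finitely many pairs of elements with equal components are equalized by
  one \<open>m\<close>, so \<open>C\<close> preserves finite limits. Conversely, the equalizer of left multiplication by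
  \<open>m1\<close> and by \<open>m2\<close> on \<open>M\<close> is \<open>{m. m1 m = m2 m}\<close>, which is nonempty as soon as this equalizer is
  preserved by a functor that sends \<open>M\<close> to a singleton and the empty set to the empty set. For
  pullbacks, the equalizer is replaced by a pullback along the diagonal of \<open>M \<times> M\<close>. Finally, \<open>C\<close> is
  terminal among all left adjoints \<open>PSh U M \<rightarrow> Set\<close>, so it is a terminal point once it preserves
  finite limits; and if a point \<open>T\<close> is terminal, the Yoneda lemma applied to the point given by the
  forgetful functor shows that \<open>T\<close> sends \<open>M\<close> to a singleton.
\<close>

section \<open>Functors and finite limits\<close>

text \<open>Two facts about a left adjoint \<open>H\<close> from right \<open>M\<close>-sets to sets
  are usually read off from colimits: \<open>H\<close> sends the empty right \<open>M\<close>-set to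
  the empty set, and a transformation out of \<open>H\<close> is determined by its component at
  \<open>M\<close>, every right \<open>M\<close>-set being a colimit of copies of \<open>M\<close>.
  Here both come from the hom-set bijection of the adjunction, by counting maps into a two-element
  set and by evaluating transposed maps at the unit of \<open>M\<close>. The forgetful functor is a
  point because it has a right adjoint, which sends \<open>S\<close> to the functions
  \<open>M \<rightarrow> S\<close>; this is where the universe has to be closed under
  \<open>M\<close>-fold powers. The carriers of objects of \<open>PSh U M\<close> are sets of
  elements of \<open>'u\<close>, whereas elements of \<open>M\<close>, pairs and functions have
  other types, so \<open>M\<close> itself, pullbacks and function sets enter only as copies along
  chosen injections into \<open>'u\<close>.\<close>

lemma cat_Idt: "is_category C \<Longrightarrow> X \<in> Ob C \<Longrightarrow> Idt C X \<in> Arr C X X"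
  unfolding is_category_def by blast

lemma cat_Comp:
  "is_category C \<Longrightarrow> X \<in> Ob C \<Longrightarrow> Y \<in> Ob C \<Longrightarrow> Z \<in> Ob C \<Longrightarrow> f \<in> Arr C X Y \<Longrightarrow> g \<in> Arr C Y Z \<Longrightarrow>
   Comp C X Y Z g f \<in> Arr C X Z"
  unfolding is_category_def by blast

lemma cat_unit:
  assumes "is_category C" "X \<in> Ob C" "Y \<in> Ob C" "f \<in> Arr C X Y"
  shows "Comp C X X Y f (Idt C X) = f" "Comp C X Y Y (Idt C Y) f = f"
  using assms unfolding is_category_def by blast+

lemma cat_assoc:
  assumes "is_category C" "W \<in> Ob C" "X \<in> Ob C" "Y \<in> Ob C" "Z \<in> Ob C"
    and "f \<in> Arr C W X" "g \<in> Arr C X Y" "h \<in> Arr C Y Z"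
  shows "Comp C W X Z (Comp C X Y Z h g) f = Comp C W Y Z h (Comp C W X Y g f)"
  using assms unfolding is_category_def by blast

lemma functor_Ob: "is_functor C D F \<Longrightarrow> X \<in> Ob C \<Longrightarrow> fobj F X \<in> Ob D"
  unfolding is_functor_def by blast

lemma functor_Arr:
  "is_functor C D F \<Longrightarrow> X \<in> Ob C \<Longrightarrow> Y \<in> Ob C \<Longrightarrow> f \<in> Arr C X Y \<Longrightarrow>
   fmap F X Y f \<in> Arr D (fobj F X) (fobj F Y)"
  unfolding is_functor_def by blast

lemma functor_Idt: "is_functor C D F \<Longrightarrow> X \<in> Ob C \<Longrightarrow> fmap F X X (Idt C X) = Idt D (fobj F X)"
  unfolding is_functor_def by blast

lemma functor_Comp:
  "is_functor C D F \<Longrightarrow> X \<in> Ob C \<Longrightarrow> Y \<in> Ob C \<Longrightarrow> Z \<in> Ob C \<Longrightarrow> f \<in> Arr C X Y \<Longrightarrow> g \<in> Arr C Y Z \<Longrightarrow>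
   fmap F X Z (Comp C X Y Z g f) =
     Comp D (fobj F X) (fobj F Y) (fobj F Z) (fmap F Y Z g) (fmap F X Y f)"
  unfolding is_functor_def by blast

lemma cone_image:
  assumes F: "is_functor C D F" and E: "is_functor J C E" and p: "is_cone J C E L p"
  shows "is_cone J D (comp_functor F E) (fobj F L) (\<lambda>i. fmap F L (fobj E i) (p i))"
proof -
  have L: "L \<in> Ob C" and pA: "\<And>i. i \<in> Ob J \<Longrightarrow> p i \<in> Arr C L (fobj E i)"
    and pc: "\<And>i j a. i \<in> Ob J \<Longrightarrow> j \<in> Ob J \<Longrightarrow> a \<in> Arr J i j \<Longrightarrow>
      Comp C L (fobj E i) (fobj E j) (fmap E i j a) (p i) = p j"
    using p unfolding is_cone_def by blast+
  have "Comp D (fobj F L) (fobj F (fobj E i)) (fobj F (fobj E j))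
      (fmap F (fobj E i) (fobj E j) (fmap E i j a)) (fmap F L (fobj E i) (p i)) =
      fmap F L (fobj E j) (p j)"
    if "i \<in> Ob J" "j \<in> Ob J" "a \<in> Arr J i j" for i j a
    using that functor_Comp[OF F L functor_Ob[OF E] functor_Ob[OF E] pA functor_Arr[OF E]]
    by (simp add: pc)
  then show ?thesis
    unfolding is_cone_def comp_functor_def
    using functor_Ob[OF F L] functor_Arr[OF F L functor_Ob[OF E] pA] by simp
qed

section \<open>Equalizers as limits over the parallel pair\<close>

text \<open>Identities are named 0 and the two parallel arrows 0 and 1. Of two composable arrows at
  least one is an identity, so addition returns the other one.\<close>

definition parallel_pair :: "(nat, nat) cat" where
  "parallel_pair =
     \<lparr> Ob = {0, 1}, Arr = (\<lambda>i j. if i = j then {0} else if i < j then {0, 1} else {}),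
       Idt = (\<lambda>_. 0), Comp = (\<lambda>_ _ _ g f. g + f) \<rparr>"

lemma category_parallel_pair: "is_category parallel_pair"
  unfolding is_category_def parallel_pair_def by auto

text \<open>A cone is determined by its leg at object 0: the leg at 1 is the composite with
  \<open>f\<close>, and by associativity a mediating arrow that is correct at 0 is correct at 1. The
  diagram \<open>D\<close> is constrained only by its values, so that the equivalence applies both
  to a diagram in the source category and to its image under a functor.\<close>

lemma limit_parallel_pair_iff:
  assumes C: "is_category C" and X: "X \<in> Ob C" and Y: "Y \<in> Ob C"
    and f: "f \<in> Arr C X Y" and g: "g \<in> Arr C X Y"
    and D: "fobj D 0 = X" "fobj D 1 = Y" "fmap D 0 0 0 = Idt C X" "fmap D 1 1 0 = Idt C Y"
      "fmap D 0 1 0 = f" "fmap D 0 1 1 = g"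
  shows "is_limit parallel_pair C D E p \<longleftrightarrow>
    is_equalizer C X Y f g E (p 0) \<and> p 1 = Comp C E X Y f (p 0)"
proof -
  have cone: "is_cone parallel_pair C D L q \<longleftrightarrow> L \<in> Ob C \<and> q 0 \<in> Arr C L X \<and>
      q 1 = Comp C L X Y f (q 0) \<and> Comp C L X Y f (q 0) = Comp C L X Y g (q 0)" for L q
    unfolding is_cone_def parallel_pair_def using X Y f g D[unfolded One_nat_def] cat_unit[OF C]
      cat_Comp[OF C]
    by (auto simp: all_conj_distrib)
  have u: "(\<forall>i\<in>Ob parallel_pair. Comp C W E (fobj D i) (p i) u = q i) \<longleftrightarrow>
      Comp C W E X (p 0) u = q 0"
    if "E \<in> Ob C" "p 0 \<in> Arr C E X" "p 1 = Comp C E X Y f (p 0)" "u \<in> Arr C W E"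
      "is_cone parallel_pair C D W q" for W u q
    using that(5) cat_assoc[OF C _ that(1) X Y that(4,2) f] that(3) D(1,2)
    unfolding cone by (auto simp: parallel_pair_def)
  show ?thesis
  proof (intro iffI conjI)
    assume L: "is_limit parallel_pair C D E p"
    then have c: "E \<in> Ob C" "p 0 \<in> Arr C E X" "p 1 = Comp C E X Y f (p 0)"
      "Comp C E X Y f (p 0) = Comp C E X Y g (p 0)"
      unfolding is_limit_def cone by blast+
    show "p 1 = Comp C E X Y f (p 0)" by fact
    show "is_equalizer C X Y f g E (p 0)"
      unfolding is_equalizer_def
    proof (intro conjI ballI impI)
      fix W r
      assume W: "W \<in> Ob C" "r \<in> Arr C W X" "Comp C W X Y f r = Comp C W X Y g r"
      let ?q = "\<lambda>i::nat. if i = 0 then r else Comp C W X Y f r"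
      have q: "is_cone parallel_pair C D W ?q" unfolding cone using W by simp
      then have "\<exists>!u. u \<in> Arr C W E \<and>
          (\<forall>i\<in>Ob parallel_pair. Comp C W E (fobj D i) (p i) u = ?q i)"
        using L unfolding is_limit_def by blast
      then show "\<exists>!u. u \<in> Arr C W E \<and> Comp C W E X (p 0) u = r"
        using u[OF c(1-3) _ q] by (simp cong: conj_cong)
    qed (use c X Y f g in auto)
  next
    assume L: "is_equalizer C X Y f g E (p 0) \<and> p 1 = Comp C E X Y f (p 0)"
    then have c: "E \<in> Ob C" "p 0 \<in> Arr C E X" "p 1 = Comp C E X Y f (p 0)"
      "Comp C E X Y f (p 0) = Comp C E X Y g (p 0)"
      unfolding is_equalizer_def by blast+
    show "is_limit parallel_pair C D E p"
      unfolding is_limit_def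
    proof (intro conjI allI impI)
      show "is_cone parallel_pair C D E p" unfolding cone using c by blast
    next
      fix W q
      assume q: "is_cone parallel_pair C D W q"
      then have "\<exists>!u. u \<in> Arr C W E \<and> Comp C W E X (p 0) u = q 0"
        using L unfolding is_equalizer_def cone by blast
      then show "\<exists>!u. u \<in> Arr C W E \<and>
          (\<forall>i\<in>Ob parallel_pair. Comp C W E (fobj D i) (p i) u = q i)"
        using u[OF c(1-3) _ q] by (simp cong: conj_cong)
    qed
  qed
qed

lemma preserves_equalizers_if_finite_limits:
  assumes C: "is_category C" and D: "is_category D" and F: "is_functor C D F"
    and lim: "preserves_finite_limits C D F"
  shows "preserves_equalizers C D F"
  unfolding preserves_equalizers_def
proof (intro allI impI)
  fix X Y f g E e
  assume eq: "is_equalizer C X Y f g E e"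
  then have c: "X \<in> Ob C" "Y \<in> Ob C" "E \<in> Ob C" "f \<in> Arr C X Y" "g \<in> Arr C X Y" "e \<in> Arr C E X"
    unfolding is_equalizer_def by blast+
  define K where "K = \<lparr> fobj = (\<lambda>i::nat. if i = 0 then X else Y),
    fmap = (\<lambda>i j (a::nat). if i = j then Idt C (if i = 0 then X else Y) else if a = 0 then f else g) \<rparr>"
  define p where "p i = (if i = 0 then e else Comp C E X Y f e)" for i :: nat
  have K: "is_functor parallel_pair C K"
    unfolding is_functor_def K_def parallel_pair_def
    using c cat_Idt[OF C] cat_unit[OF C] by auto
  have "is_limit parallel_pair C K E p"
    by (subst limit_parallel_pair_iff[OF C c(1,2,4,5)]) (use eq in \<open>simp_all add: K_def p_def\<close>)
  then have "is_limit parallel_pair D (comp_functor F K) (fobj F E)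
      (\<lambda>i. fmap F E (fobj K i) (p i))"
    using lim K category_parallel_pair unfolding preserves_finite_limits_def
    by (auto simp: parallel_pair_def)
  then show "is_equalizer D (fobj F X) (fobj F Y) (fmap F X Y f) (fmap F X Y g)
      (fobj F E) (fmap F E X e)"
    by (subst (asm) limit_parallel_pair_iff[OF D functor_Ob[OF F c(1)] functor_Ob[OF F c(2)]
          functor_Arr[OF F c(1,2,4)] functor_Arr[OF F c(1,2,5)]])
       (use c functor_Idt[OF F] in \<open>simp_all add: K_def p_def comp_functor_def\<close>)
qed

section \<open>Pullbacks as limits over the cospan\<close>

text \<open>Object 2 is the common target of the cospan. Any two objects are joined by at most one
  arrow in each direction, so a single name for arrows suffices.\<close>

definition cospan :: "(nat, nat) cat" where
  "cospan =
     \<lparr> Ob = {0, 1, 2}, Arr = (\<lambda>i j. if i = j \<or> j = 2 then {0} else {}),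
       Idt = (\<lambda>_. 0), Comp = (\<lambda>_ _ _ g f. 0) \<rparr>"

lemma category_cospan: "is_category cospan"
  unfolding is_category_def cospan_def by auto

lemma limit_cospan_iff:
  assumes C: "is_category C" and X: "X \<in> Ob C" and Y: "Y \<in> Ob C" and Z: "Z \<in> Ob C"
    and f: "f \<in> Arr C X Z" and g: "g \<in> Arr C Y Z"
    and D: "fobj D 0 = X" "fobj D 1 = Y" "fobj D 2 = Z"
      "fmap D 0 0 0 = Idt C X" "fmap D 1 1 0 = Idt C Y" "fmap D 2 2 0 = Idt C Z"
      "fmap D 0 2 0 = f" "fmap D 1 2 0 = g"
  shows "is_limit cospan C D P p \<longleftrightarrow>
    is_pullback C X Y Z f g P (p 0) (p 1) \<and> p 2 = Comp C P X Z f (p 0)"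
proof -
  have cone: "is_cone cospan C D L q \<longleftrightarrow> L \<in> Ob C \<and> q 0 \<in> Arr C L X \<and> q 1 \<in> Arr C L Y \<and>
      q 2 = Comp C L X Z f (q 0) \<and> Comp C L X Z f (q 0) = Comp C L Y Z g (q 1)" for L q
    unfolding is_cone_def cospan_def using X Y Z f g D[unfolded One_nat_def] cat_unit[OF C]
      cat_Comp[OF C]
    by (auto simp: all_conj_distrib)
  have u: "(\<forall>i\<in>Ob cospan. Comp C W P (fobj D i) (p i) u = q i) \<longleftrightarrow>
      Comp C W P X (p 0) u = q 0 \<and> Comp C W P Y (p 1) u = q 1"
    if "P \<in> Ob C" "p 0 \<in> Arr C P X" "p 2 = Comp C P X Z f (p 0)" "u \<in> Arr C W P"
      "is_cone cospan C D W q" for W u q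
    using that(5) cat_assoc[OF C _ that(1) X Z that(4,2) f] that(3) D(1-3)
    unfolding cone by (auto simp: cospan_def)
  show ?thesis
  proof (intro iffI conjI)
    assume L: "is_limit cospan C D P p"
    then have c: "P \<in> Ob C" "p 0 \<in> Arr C P X" "p 2 = Comp C P X Z f (p 0)" "p 1 \<in> Arr C P Y"
      "Comp C P X Z f (p 0) = Comp C P Y Z g (p 1)"
      unfolding is_limit_def cone by blast+
    show "p 2 = Comp C P X Z f (p 0)" by fact
    show "is_pullback C X Y Z f g P (p 0) (p 1)"
      unfolding is_pullback_def
    proof (intro conjI ballI impI)
      fix W r s
      assume W: "W \<in> Ob C" "r \<in> Arr C W X" "s \<in> Arr C W Y" "Comp C W X Z f r = Comp C W Y Z g s"
      let ?q = "\<lambda>i::nat. if i = 0 then r else if i = 1 then s else Comp C W X Z f r"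
      have q: "is_cone cospan C D W ?q" unfolding cone using W by simp
      then have "\<exists>!u. u \<in> Arr C W P \<and> (\<forall>i\<in>Ob cospan. Comp C W P (fobj D i) (p i) u = ?q i)"
        using L unfolding is_limit_def by blast
      then show "\<exists>!u. u \<in> Arr C W P \<and> Comp C W P X (p 0) u = r \<and> Comp C W P Y (p 1) u = s"
        using u[OF c(1-3) _ q] by (simp cong: conj_cong)
    qed (use c X Y Z f g in auto)
  next
    assume L: "is_pullback C X Y Z f g P (p 0) (p 1) \<and> p 2 = Comp C P X Z f (p 0)"
    then have c: "P \<in> Ob C" "p 0 \<in> Arr C P X" "p 2 = Comp C P X Z f (p 0)" "p 1 \<in> Arr C P Y"
      "Comp C P X Z f (p 0) = Comp C P Y Z g (p 1)"
      unfolding is_pullback_def by blast+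
    show "is_limit cospan C D P p"
      unfolding is_limit_def
    proof (intro conjI allI impI)
      show "is_cone cospan C D P p" unfolding cone using c by blast
    next
      fix W q
      assume q: "is_cone cospan C D W q"
      then have "\<exists>!u. u \<in> Arr C W P \<and> Comp C W P X (p 0) u = q 0 \<and> Comp C W P Y (p 1) u = q 1"
        using L unfolding is_pullback_def cone by blast
      then show "\<exists>!u. u \<in> Arr C W P \<and> (\<forall>i\<in>Ob cospan. Comp C W P (fobj D i) (p i) u = q i)"
        using u[OF c(1-3) _ q] by (simp cong: conj_cong)
    qed
  qed
qed

lemma preserves_pullbacks_if_finite_limits:
  assumes C: "is_category C" and D: "is_category D" and F: "is_functor C D F"
    and lim: "preserves_finite_limits C D F"
  shows "preserves_pullbacks C D F"
  unfolding preserves_pullbacks_def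
proof (intro allI impI)
  fix X Y Z f g P r s
  assume pb: "is_pullback C X Y Z f g P r s"
  then have c: "X \<in> Ob C" "Y \<in> Ob C" "Z \<in> Ob C" "P \<in> Ob C" "f \<in> Arr C X Z" "g \<in> Arr C Y Z"
      "r \<in> Arr C P X" "s \<in> Arr C P Y"
    unfolding is_pullback_def by blast+
  define ob where "ob i = (if i = 0 then X else if i = 1 then Y else Z)" for i :: nat
  define K where "K = \<lparr> fobj = ob,
    fmap = (\<lambda>i j (a::nat). if i = j then Idt C (ob i) else if i = 0 then f else g) \<rparr>"
  define p where "p i = (if i = 0 then r else if i = 1 then s else Comp C P X Z f r)" for i :: nat
  have K: "is_functor cospan C K"
    unfolding is_functor_def K_def cospan_def ob_def
    using c cat_Idt[OF C] cat_unit[OF C] by auto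
  have "is_limit cospan C K P p"
    by (subst limit_cospan_iff[OF C c(1,2,3,5,6)]) (use pb in \<open>simp_all add: K_def p_def ob_def\<close>)
  then have "is_limit cospan D (comp_functor F K) (fobj F P) (\<lambda>i. fmap F P (fobj K i) (p i))"
    using lim K category_cospan unfolding preserves_finite_limits_def
    by (auto simp: cospan_def)
  then show "is_pullback D (fobj F X) (fobj F Y) (fobj F Z) (fmap F X Z f) (fmap F Y Z g)
      (fobj F P) (fmap F P X r) (fmap F P Y s)"
    by (subst (asm) limit_cospan_iff[OF D functor_Ob[OF F c(1)] functor_Ob[OF F c(2)]
          functor_Ob[OF F c(3)] functor_Arr[OF F c(1,3,5)] functor_Arr[OF F c(2,3,6)]])
       (use c functor_Idt[OF F] in \<open>simp_all add: K_def p_def ob_def comp_functor_def\<close>)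
qed

section \<open>Adjunctions\<close>

text \<open>\<open>left_adjoint\<close> states naturality in both variables by one equation. Taking
  an identity for \<open>k\<close> or for \<open>h\<close> separates it into two equations that can
  be used for rewriting.\<close>

lemma left_adjointE:
  assumes adj: "left_adjoint C D F G" and C: "is_category C" and D: "is_category D"
  obtains \<phi> where
    "\<And>X Y. X \<in> Ob C \<Longrightarrow> Y \<in> Ob D \<Longrightarrow>
      bij_betw (\<phi> X Y) (Arr D (fobj F X) Y) (Arr C X (fobj G Y))"
    and "\<And>X X' Y h g. \<lbrakk>X \<in> Ob C; X' \<in> Ob C; Y \<in> Ob D; h \<in> Arr C X' X; g \<in> Arr D (fobj F X) Y\<rbrakk> \<Longrightarrow>
      \<phi> X' Y (Comp D (fobj F X') (fobj F X) Y g (fmap F X' X h)) =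
      Comp C X' X (fobj G Y) (\<phi> X Y g) h"
    and "\<And>X Y Y' g k. \<lbrakk>X \<in> Ob C; Y \<in> Ob D; Y' \<in> Ob D; g \<in> Arr D (fobj F X) Y; k \<in> Arr D Y Y'\<rbrakk> \<Longrightarrow>
      \<phi> X Y' (Comp D (fobj F X) Y Y' k g) =
      Comp C X (fobj G Y) (fobj G Y') (fmap G Y Y' k) (\<phi> X Y g)"
proof -
  have F: "is_functor C D F" and G: "is_functor D C G"
    using adj unfolding left_adjoint_def by blast+
  obtain \<phi> where bij: "\<forall>X\<in>Ob C. \<forall>Y\<in>Ob D.
      bij_betw (\<phi> X Y) (Arr D (fobj F X) Y) (Arr C X (fobj G Y))"
    and nat: "\<forall>X\<in>Ob C. \<forall>X'\<in>Ob C. \<forall>Y\<in>Ob D. \<forall>Y'\<in>Ob D.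
       \<forall>h\<in>Arr C X' X. \<forall>g\<in>Arr D (fobj F X) Y. \<forall>k\<in>Arr D Y Y'.
       \<phi> X' Y' (Comp D (fobj F X') Y Y' k
                  (Comp D (fobj F X') (fobj F X) Y g (fmap F X' X h))) =
       Comp C X' (fobj G Y) (fobj G Y') (fmap G Y Y' k)
         (Comp C X' X (fobj G Y) (\<phi> X Y g) h)"
    using adj unfolding left_adjoint_def by blast
  have \<phi>A: "\<phi> X Y g \<in> Arr C X (fobj G Y)" if "X \<in> Ob C" "Y \<in> Ob D" "g \<in> Arr D (fobj F X) Y"
    for X Y g using bij that unfolding bij_betw_def by blast
  show thesis
  proof (rule that)
    show "bij_betw (\<phi> X Y) (Arr D (fobj F X) Y) (Arr C X (fobj G Y))"
      if "X \<in> Ob C" "Y \<in> Ob D" for X Y using bij that by blast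
  next
    fix X X' Y h g
    assume X: "X \<in> Ob C" and X': "X' \<in> Ob C" and Y: "Y \<in> Ob D" and h: "h \<in> Arr C X' X"
      and g: "g \<in> Arr D (fobj F X) Y"
    have "Comp D (fobj F X') (fobj F X) Y g (fmap F X' X h) \<in> Arr D (fobj F X') Y"
      using cat_Comp[OF D functor_Ob[OF F X'] functor_Ob[OF F X] Y functor_Arr[OF F X' X h] g] .
    moreover have "Comp C X' X (fobj G Y) (\<phi> X Y g) h \<in> Arr C X' (fobj G Y)"
      using cat_Comp[OF C X' X functor_Ob[OF G Y] h \<phi>A[OF X Y g]] .
    ultimately show "\<phi> X' Y (Comp D (fobj F X') (fobj F X) Y g (fmap F X' X h)) =
        Comp C X' X (fobj G Y) (\<phi> X Y g) h"
      using nat X X' Y h g cat_Idt[OF D Y] functor_Idt[OF G Y] cat_unit(2)[OF D functor_Ob[OF F X'] Y]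
        cat_unit(2)[OF C X' functor_Ob[OF G Y]] by metis
  next
    fix X Y Y' g k
    assume X: "X \<in> Ob C" and Y: "Y \<in> Ob D" and Y': "Y' \<in> Ob D" and g: "g \<in> Arr D (fobj F X) Y"
      and k: "k \<in> Arr D Y Y'"
    show "\<phi> X Y' (Comp D (fobj F X) Y Y' k g) =
        Comp C X (fobj G Y) (fobj G Y') (fmap G Y Y' k) (\<phi> X Y g)"
      using nat X Y Y' g k cat_Idt[OF C X] functor_Idt[OF F X] cat_unit(1)[OF D functor_Ob[OF F X] Y g]
        cat_unit(1)[OF C X functor_Ob[OF G Y] \<phi>A[OF X Y g]] by metis
  qed
qed

section \<open>Right \<open>M\<close>-sets\<close>

lemma set_cat_simps [simp]:
  "X \<in> Ob (set_cat U) \<longleftrightarrow> is_small U X"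
  "Arr (set_cat U) X Y = X \<rightarrow>\<^sub>E Y"
  "Idt (set_cat U) X = (\<lambda>x\<in>X. x)"
  "Comp (set_cat U) X Y Z g f = compose X g f"
  unfolding set_cat_def by simp_all

lemma PSh_simps [simp]:
  "X \<in> Ob (PSh U M) \<longleftrightarrow> right_mset M X \<and> is_small U (rcar X)"
  "Idt (PSh U M) X = (\<lambda>x\<in>rcar X. x)"
  "Comp (PSh U M) X Y Z g f = compose (rcar X) g f"
  unfolding PSh_def by simp_all

lemma Arr_PSh_iff:
  "f \<in> Arr (PSh U M) X Y \<longleftrightarrow> f \<in> rcar X \<rightarrow>\<^sub>E rcar Y \<and>
     (\<forall>x\<in>rcar X. \<forall>m\<in>carrier M. f (ract X x m) = ract Y (f x) m)"
  unfolding PSh_def by simp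

lemma compose_restrict_id:
  assumes "f \<in> X \<rightarrow>\<^sub>E Y"
  shows "compose X f (\<lambda>x\<in>X. x) = f" "compose X (\<lambda>y\<in>Y. y) f = f"
  using assms by (auto simp: compose_def fun_eq_iff PiE_def Pi_def extensional_def)

lemma category_set_cat: "is_category (set_cat U)"
  unfolding is_category_def by (auto simp: compose_restrict_id) (auto simp: compose_def fun_eq_iff)

section \<open>Small sets and their codes\<close>

lemma is_small_iff:
  assumes "set_universe M U"
  shows "is_small U (A :: 'u set) \<longleftrightarrow> U A"
  using assms eqpoll_imp_lepoll eqpoll_refl unfolding is_small_def set_universe_def by metis

text \<open>Closure under \<open>\<lesssim>\<close> is assumed only for subsets of
  \<open>'u\<close>. A set \<open>B\<close> of any type is handled through its injective image in a
  subset of \<open>'u\<close> that witnesses the smallness of \<open>A\<close>.\<close>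

lemma is_small_lepoll:
  assumes U: "set_universe M U" and A: "is_small U A" and BA: "B \<lesssim> A"
  shows "is_small U B"
proof -
  obtain A0 f where "U A0" "inj_on f B" "f ` B \<subseteq> A0"
    using A BA lepoll_trans2 unfolding is_small_def lepoll_def[of B] by (metis lepoll_def)
  then have "U (f ` B)" "B \<approx> f ` B"
    using U subset_imp_lepoll[of "f ` B" A0] inj_on_image_eqpoll_self[of f B]
    unfolding set_universe_def by (auto intro: eqpoll_sym)
  then show ?thesis unfolding is_small_def by blast
qed

lemma is_small_image: "set_universe M U \<Longrightarrow> is_small U A \<Longrightarrow> is_small U (f ` A)"
  using is_small_lepoll image_lepoll by blast

lemma is_small_subset: "set_universe M U \<Longrightarrow> is_small U A \<Longrightarrow> B \<subseteq> A \<Longrightarrow> is_small U B"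
  using is_small_lepoll subset_imp_lepoll by blast

lemma is_small_singleton:
  assumes "set_universe M U"
  shows "is_small U {x}"
proof -
  have "U {undefined}" "{x} \<approx> {undefined}"
    using assms singleton_eqpoll unfolding set_universe_def by auto
  then show ?thesis unfolding is_small_def by blast
qed

lemma is_small_eqpoll: "is_small U A \<Longrightarrow> A \<approx> B \<Longrightarrow> is_small U B"
  unfolding is_small_def by (meson eqpoll_sym eqpoll_trans)

lemma is_small_Times:
  assumes U: "set_universe M U" and A: "is_small U A" and B: "is_small U B"
  shows "is_small U (A \<times> B)"
proof -
  obtain A0 B0 where "U A0" "A \<approx> A0" "U B0" "B \<approx> B0" using A B unfolding is_small_def by blast
  moreover from this have "is_small U (A0 \<times> B0)" using U unfolding set_universe_def by blast
  ultimately show ?thesis using is_small_eqpoll times_eqpoll_cong eqpoll_sym by metis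
qed

text \<open>One fixed injection for each small set. It lets right \<open>M\<close>-sets whose
  natural elements are monoid elements, pairs or functions be replaced by isomorphic ones with
  carrier in \<open>'u\<close>, as \<open>PSh U M\<close> demands.\<close>

definition encode :: "('u set \<Rightarrow> bool) \<Rightarrow> 'a set \<Rightarrow> 'a \<Rightarrow> 'u" where
  "encode U A = (SOME f. inj_on f A \<and> U (f ` A))"

lemma encode:
  assumes "is_small U A"
  shows "inj_on (encode U A) A" "U (encode U A ` A)"
proof -
  obtain f where "inj_on f A" "U (f ` A)"
    using assms unfolding is_small_def eqpoll_def bij_betw_def by blast
  then have "inj_on (encode U A) A \<and> U (encode U A ` A)"
    unfolding encode_def by (intro someI[of "\<lambda>f. inj_on f A \<and> U (f ` A)" f]) simp
  then show "inj_on (encode U A) A" "U (encode U A ` A)" by auto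
qed

definition encode_rset :: "('u set \<Rightarrow> bool) \<Rightarrow> ('x, 'm) rset \<Rightarrow> ('u, 'm) rset" where
  "encode_rset U X =
     \<lparr> rcar = encode U (rcar X) ` rcar X,
       ract = (\<lambda>y m. encode U (rcar X) (ract X (the_inv_into (rcar X) (encode U (rcar X)) y) m)) \<rparr>"

lemma rcar_encode_rset: "rcar (encode_rset U X) = encode U (rcar X) ` rcar X"
  unfolding encode_rset_def by simp

lemma ract_encode_rset:
  assumes "is_small U (rcar X)" "x \<in> rcar X"
  shows "ract (encode_rset U X) (encode U (rcar X) x) m = encode U (rcar X) (ract X x m)"
  using assms unfolding encode_rset_def by (simp add: the_inv_into_f_f encode)

lemma encode_rset_Ob:
  assumes X: "right_mset M X" and small: "is_small U (rcar X)" and U: "set_universe M U"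
  shows "encode_rset U X \<in> Ob (PSh U M)"
proof -
  have "right_mset M (encode_rset U X)"
    using X ract_encode_rset[OF small] unfolding right_mset_def
    by (simp add: rcar_encode_rset)
  then show ?thesis using encode(2)[OF small] by (simp add: rcar_encode_rset is_small_iff[OF U])
qed

section \<open>Limits of sets in terms of elements\<close>

text \<open>A cone from \<open>X\<close> is a family of compatible families indexed by the elements
  of \<open>X\<close>. If each compatible family comes from exactly one element of \<open>L\<close>,
  these elements assemble into the unique mediating map.\<close>

lemma set_limitI:
  assumes cone: "is_cone J (set_cat U) D L p"
    and ex: "\<And>x. \<lbrakk>\<And>i. i \<in> Ob J \<Longrightarrow> x i \<in> fobj D i;
        \<And>i j a. \<lbrakk>i \<in> Ob J; j \<in> Ob J; a \<in> Arr J i j\<rbrakk> \<Longrightarrow> fmap D i j a (x i) = x j\<rbrakk> \<Longrightarrow>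
      \<exists>!l. l \<in> L \<and> (\<forall>i\<in>Ob J. p i l = x i)"
  shows "is_limit J (set_cat U) D L p"
  unfolding is_limit_def
proof (intro conjI allI impI)
  fix X q
  assume "is_cone J (set_cat U) D X q"
  then have qA: "\<And>i. i \<in> Ob J \<Longrightarrow> q i \<in> X \<rightarrow>\<^sub>E fobj D i"
    and qc: "\<And>i j a. i \<in> Ob J \<Longrightarrow> j \<in> Ob J \<Longrightarrow> a \<in> Arr J i j \<Longrightarrow>
      compose X (fmap D i j a) (q i) = q j"
    unfolding is_cone_def by auto
  have 1: "\<exists>!l. l \<in> L \<and> (\<forall>i\<in>Ob J. p i l = q i x)" if x: "x \<in> X" for x
  proof (rule ex)
    show "q i x \<in> fobj D i" if "i \<in> Ob J" for i using qA[OF that] x by auto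
    show "fmap D i j a (q i x) = q j x" if "i \<in> Ob J" "j \<in> Ob J" "a \<in> Arr J i j" for i j a
      using qc[OF that] x by (metis compose_eq)
  qed
  define u where "u = (\<lambda>x\<in>X. THE l. l \<in> L \<and> (\<forall>i\<in>Ob J. p i l = q i x))"
  have 2: "u x \<in> L \<and> (\<forall>i\<in>Ob J. p i (u x) = q i x)" if "x \<in> X" for x
    using theI'[OF 1[OF that]] that by (simp add: u_def)
  show "\<exists>!u. u \<in> Arr (set_cat U) X L \<and>
      (\<forall>i\<in>Ob J. Comp (set_cat U) X L (fobj D i) (p i) u = q i)"
  proof (rule ex1I[of _ u], intro conjI ballI)
    show "u \<in> Arr (set_cat U) X L" using 2 by (auto simp: u_def)
    show "Comp (set_cat U) X L (fobj D i) (p i) u = q i" if "i \<in> Ob J" for i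
      using 2 qA[OF that] that by (auto simp: compose_def fun_eq_iff PiE_def extensional_def)
  next
    fix v
    assume v: "v \<in> Arr (set_cat U) X L \<and>
      (\<forall>i\<in>Ob J. Comp (set_cat U) X L (fobj D i) (p i) v = q i)"
    show "v = u"
    proof (rule extensionalityI[of _ X])
      show "v \<in> extensional X" "u \<in> extensional X" using v by (auto simp: u_def PiE_def)
      fix x assume x: "x \<in> X"
      have "v x \<in> L \<and> (\<forall>i\<in>Ob J. p i (v x) = q i x)"
        using v x compose_eq[of x X] by (metis PiE_mem set_cat_simps(2,4))
      then show "v x = u x" using 1[OF x] 2[OF x] by blast
    qed
  qed
qed (rule cone)

text \<open>The universal property is tested on maps from a one-element set; \<open>{x}\<close> is
  one that has the right type and is small.\<close>

lemma set_pullback_elements: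
  assumes U: "set_universe M U" and pb: "is_pullback (set_cat U) X Y Z f g P p q"
    and xy: "x \<in> X" "y \<in> Y" "f x = g y"
  shows "\<exists>!z. z \<in> P \<and> p z = x \<and> q z = y"
proof -
  let ?W = "{x}"
  let ?r = "\<lambda>w\<in>?W. x" and ?s = "\<lambda>w\<in>?W. y"
  have "?W \<in> Ob (set_cat U)" using is_small_singleton[OF U] by simp
  moreover have "?r \<in> Arr (set_cat U) ?W X" "?s \<in> Arr (set_cat U) ?W Y" using xy by auto
  moreover have "Comp (set_cat U) ?W X Z f ?r = Comp (set_cat U) ?W Y Z g ?s"
    using xy by (auto simp: compose_def)
  ultimately have ex1: "\<exists>!u. u \<in> ?W \<rightarrow>\<^sub>E P \<and> compose ?W p u = ?r \<and> compose ?W q u = ?s"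
    using pb unfolding is_pullback_def set_cat_simps(2,4) by blast
  then obtain u where u: "u \<in> ?W \<rightarrow>\<^sub>E P" "compose ?W p u = ?r" "compose ?W q u = ?s" by blast
  have pq: "compose ?W p (\<lambda>w\<in>?W. z) = ?r \<and> compose ?W q (\<lambda>w\<in>?W. z) = ?s \<longleftrightarrow> p z = x \<and> q z = y"
    for z by (auto simp: compose_def fun_eq_iff)
  have u': "u = (\<lambda>w\<in>?W. u x)" using u(1) by (auto simp: fun_eq_iff PiE_def extensional_def)
  show ?thesis
  proof (rule ex1I[of _ "u x"])
    show "u x \<in> P \<and> p (u x) = x \<and> q (u x) = y"
      using u u' pq[of "u x"] by auto
    fix z assume z: "z \<in> P \<and> p z = x \<and> q z = y"
    then have "(\<lambda>w\<in>?W. z) \<in> ?W \<rightarrow>\<^sub>E P" "compose ?W p (\<lambda>w\<in>?W. z) = ?r"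
      "compose ?W q (\<lambda>w\<in>?W. z) = ?s"
      using pq[of z] by simp_all
    then have "(\<lambda>w\<in>?W. z) = u" using ex1 u by blast
    then show "z = u x" by (metis restrict_apply' singletonI)
  qed
qed

lemma set_equalizer_elements:
  assumes U: "set_universe M U" and eq: "is_equalizer (set_cat U) X Y f g E e"
    and x: "x \<in> X" "f x = g x"
  shows "\<exists>z\<in>E. e z = x"
proof -
  let ?W = "{x}"
  let ?r = "\<lambda>w\<in>?W. x"
  have "?W \<in> Ob (set_cat U)" using is_small_singleton[OF U] by simp
  moreover have "?r \<in> Arr (set_cat U) ?W X" using x by auto
  moreover have "Comp (set_cat U) ?W X Y f ?r = Comp (set_cat U) ?W X Y g ?r"
    using x by (auto simp: compose_def)
  ultimately obtain u where u: "u \<in> ?W \<rightarrow>\<^sub>E E" "compose ?W e u = ?r"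
    using eq unfolding is_equalizer_def set_cat_simps(2,4) by blast
  have "e (u x) = x" using fun_cong[OF u(2), of x] by (simp add: compose_eq)
  then show ?thesis using u(1) by blast
qed

locale small_monoid = monoid M for M :: "('m, 'e) monoid_scheme" (structure) +
  fixes U :: "'u set \<Rightarrow> bool"
  assumes universe: "set_universe M U"
begin

abbreviation "P \<equiv> PSh U M"

lemma Ob_act:
  assumes "X \<in> Ob P" "x \<in> rcar X"
  shows "m \<in> carrier M \<Longrightarrow> ract X x m \<in> rcar X" "ract X x \<one> = x"
    "m \<in> carrier M \<Longrightarrow> n \<in> carrier M \<Longrightarrow> ract X (ract X x m) n = ract X x (m \<otimes> n)"
  using assms unfolding PSh_simps right_mset_def by blast+

lemma PSh_ArrD:
  assumes "f \<in> Arr P X Y"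
  shows "x \<in> rcar X \<Longrightarrow> f x \<in> rcar Y" "f \<in> extensional (rcar X)"
    "x \<in> rcar X \<Longrightarrow> m \<in> carrier M \<Longrightarrow> f (ract X x m) = ract Y (f x) m"
  using assms unfolding Arr_PSh_iff PiE_def by auto

lemma category_PSh: "is_category P"
  unfolding is_category_def
proof (intro conjI ballI)
  fix X assume "X \<in> Ob P"
  then show "Idt P X \<in> Arr P X X" by (auto simp: Arr_PSh_iff Ob_act simp del: PSh_simps(1))
next
  fix X Y Z f g assume "X \<in> Ob P" "f \<in> Arr P X Y" "g \<in> Arr P Y Z"
  then show "Comp P X Y Z g f \<in> Arr P X Z"
    unfolding Arr_PSh_iff[of _ U M X Z] using PSh_ArrD Ob_act(1) by (simp add: compose_def)
qed (auto simp: Arr_PSh_iff compose_restrict_id, auto simp: compose_def fun_eq_iff)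

section \<open>The regular right \<open>M\<close>-set\<close>

text \<open>The representable presheaf: \<open>M\<close> acting on itself by right multiplication,
  copied into \<open>'u\<close>.\<close>

definition reg :: "('u, 'm) rset" where
  "reg = encode_rset U \<lparr> rcar = carrier M, ract = (\<otimes>) \<rparr>"

definition code :: "'m \<Rightarrow> 'u" where
  "code = encode U (carrier M)"

lemma small_carrier: "is_small U (carrier M)"
  using universe unfolding set_universe_def by blast

lemma inj_code: "inj_on code (carrier M)"
  unfolding code_def using encode(1) small_carrier .

lemma reg_Ob: "reg \<in> Ob P"
  unfolding reg_def
  by (rule encode_rset_Ob) (auto simp: right_mset_def m_assoc small_carrier universe)

lemma rcar_reg: "rcar reg = code ` carrier M"
  unfolding reg_def code_def rcar_encode_rset by simp

lemma ract_reg: "m \<in> carrier M \<Longrightarrow> ract reg (code m) n = code (m \<otimes> n)"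
  using ract_encode_rset[of U "\<lparr> rcar = carrier M, ract = (\<otimes>) \<rparr>" m n] small_carrier
  unfolding reg_def code_def by simp

text \<open>The map \<open>M \<rightarrow> X\<close> that the Yoneda lemma assigns to
  \<open>x\<close>, namely the one with \<open>\<one> \<mapsto> x\<close>. For
  \<open>X = reg\<close> and \<open>x = code m\<close> it is left multiplication by
  \<open>m\<close>.\<close>

definition point_map :: "('u, 'm) rset \<Rightarrow> 'u \<Rightarrow> 'u \<Rightarrow> 'u" where
  "point_map X x = (\<lambda>r\<in>rcar reg. ract X x (the_inv_into (carrier M) code r))"

lemma point_map_code: "m \<in> carrier M \<Longrightarrow> point_map X x (code m) = ract X x m"
  unfolding point_map_def by (simp add: rcar_reg the_inv_into_f_f inj_code)

lemma point_map_Arr: "X \<in> Ob P \<Longrightarrow> x \<in> rcar X \<Longrightarrow> point_map X x \<in> Arr P reg X"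
  unfolding Arr_PSh_iff
  by (auto simp: rcar_reg ract_reg point_map_code Ob_act simp del: PSh_simps(1))
     (auto simp: point_map_def rcar_reg)

lemma one_reg: "code \<one> \<in> rcar reg"
  by (simp add: rcar_reg)

text \<open>By equivariance the value at \<open>m = \<one> m\<close> is the value at
  \<open>\<one>\<close> acted on by \<open>m\<close>.\<close>

lemma Arr_reg_eq:
  assumes f: "f \<in> Arr P reg X"
  shows "f = point_map X (f (code \<one>))"
proof (rule extensionalityI[of _ "rcar reg"])
  show "f \<in> extensional (rcar reg)" using PSh_ArrD(2)[OF f] .
  show "point_map X (f (code \<one>)) \<in> extensional (rcar reg)" by (simp add: point_map_def)
  fix r assume "r \<in> rcar reg"
  then obtain m where m: "m \<in> carrier M" "r = code m" by (auto simp: rcar_reg)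
  then show "f r = point_map X (f (code \<one>)) r"
    using PSh_ArrD(3)[OF f one_reg m(1)] by (simp add: ract_reg point_map_code)
qed

lemma Arr_reg_eqI:
  "f \<in> Arr P reg X \<Longrightarrow> g \<in> Arr P reg X \<Longrightarrow> f (code \<one>) = g (code \<one>) \<Longrightarrow> f = g"
  using Arr_reg_eq by metis

lemma compose_point_map:
  assumes "X \<in> Ob P" "Y \<in> Ob P" "f \<in> Arr P X Y" "x \<in> rcar X"
  shows "compose (rcar reg) f (point_map X x) = point_map Y (f x)"
proof (rule Arr_reg_eqI)
  show "compose (rcar reg) f (point_map X x) \<in> Arr P reg Y"
    using cat_Comp[OF category_PSh reg_Ob assms(1,2) point_map_Arr[OF assms(1,4)] assms(3)] by simp
  show "point_map Y (f x) \<in> Arr P reg Y" using point_map_Arr assms PSh_ArrD(1) by blast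
  show "compose (rcar reg) f (point_map X x) (code \<one>) = point_map Y (f x) (code \<one>)"
    using assms PSh_ArrD(1)[OF assms(3,4)]
    by (simp add: compose_def one_reg point_map_code Ob_act del: PSh_simps(1))
qed

text \<open>Elements of \<open>X\<close> are maps \<open>M \<rightarrow> X\<close>, so limits of right \<open>M\<close>-sets are computed on elements.\<close>

lemma limit_elements:
  assumes E: "is_functor J P E" and L: "is_limit J P E L p"
    and x: "\<And>i. i \<in> Ob J \<Longrightarrow> x i \<in> rcar (fobj E i)"
    and comp: "\<And>i j a. \<lbrakk>i \<in> Ob J; j \<in> Ob J; a \<in> Arr J i j\<rbrakk> \<Longrightarrow> fmap E i j a (x i) = x j"
  shows "\<exists>!l. l \<in> rcar L \<and> (\<forall>i\<in>Ob J. p i l = x i)"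
proof -
  have LO: "L \<in> Ob P" and pA: "\<And>i. i \<in> Ob J \<Longrightarrow> p i \<in> Arr P L (fobj E i)"
    using L unfolding is_limit_def is_cone_def by blast+
  note EO = functor_Ob[OF E]
  let ?q = "\<lambda>i. point_map (fobj E i) (x i)"
  have "is_cone J P E reg ?q"
    unfolding is_cone_def
    using reg_Ob point_map_Arr[OF EO x] compose_point_map[OF EO EO functor_Arr[OF E] x] comp
    by (simp del: PSh_simps(1))
  then have ex1: "\<exists>!u. u \<in> Arr P reg L \<and> (\<forall>i\<in>Ob J. compose (rcar reg) (p i) u = ?q i)"
    using L unfolding is_limit_def PSh_simps(3) by blast
  have iff: "compose (rcar reg) (p i) (point_map L l) = ?q i \<longleftrightarrow> p i l = x i"
    if "i \<in> Ob J" "l \<in> rcar L" for i l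
  proof -
    have "p i l \<in> rcar (fobj E i)" using PSh_ArrD(1)[OF pA[OF that(1)] that(2)] .
    then show ?thesis
      using compose_point_map[OF LO EO[OF that(1)] pA[OF that(1)] that(2)]
        point_map_code[OF one_closed] Ob_act(2)[OF EO[OF that(1)]] x[OF that(1)] by metis
  qed
  obtain u where u: "u \<in> Arr P reg L" "\<And>i. i \<in> Ob J \<Longrightarrow> compose (rcar reg) (p i) u = ?q i"
    using ex1 by blast
  let ?l = "u (code \<one>)"
  have l: "?l \<in> rcar L" using PSh_ArrD(1)[OF u(1) one_reg] .
  show ?thesis
  proof (rule ex1I[of _ ?l], intro conjI ballI)
    show "p i ?l = x i" if "i \<in> Ob J" for i
      using iff[OF that l] u(2)[OF that] Arr_reg_eq[OF u(1)] by simp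
    fix l' assume l': "l' \<in> rcar L \<and> (\<forall>i\<in>Ob J. p i l' = x i)"
    then have "point_map L l' = u"
      using ex1 u iff point_map_Arr[OF LO] by (metis (no_types, lifting))
    then show "l' = ?l" using l' LO by (metis Ob_act(2) point_map_code one_closed)
  qed (rule l)
qed

section \<open>Terminal object, equalizers and pullbacks of right \<open>M\<close>-sets\<close>

lemma terminal_mset:
  "\<lparr> rcar = {z}, ract = (\<lambda>x m. x) \<rparr> \<in> Ob P"
  using is_small_singleton[OF universe] by (simp add: right_mset_def)

lemma equalizer_exists:
  assumes X: "X \<in> Ob P" and Y: "Y \<in> Ob P" and f: "f \<in> Arr P X Y" and g: "g \<in> Arr P X Y"
  shows "\<exists>E e. is_equalizer P X Y f g E e"
proof -
  let ?E = "\<lparr> rcar = {x\<in>rcar X. f x = g x}, ract = ract X \<rparr>"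
  let ?e = "\<lambda>x\<in>rcar ?E. x"
  have E: "?E \<in> Ob P"
    using X is_small_subset[OF universe, of "rcar X" "rcar ?E"] PSh_ArrD(3)[OF f] PSh_ArrD(3)[OF g]
    by (auto simp: right_mset_def)
  have e: "?e \<in> Arr P ?E X"
    using Ob_act(1)[OF E] by (auto simp: Arr_PSh_iff)
  have "is_equalizer P X Y f g ?E ?e"
    unfolding is_equalizer_def
  proof (intro conjI ballI impI)
    show "Comp P ?E X Y f ?e = Comp P ?E X Y g ?e" by (auto simp: compose_def fun_eq_iff)
  next
    fix W r assume W: "W \<in> Ob P" "r \<in> Arr P W X" "Comp P W X Y f r = Comp P W X Y g r"
    have fg: "f (r w) = g (r w)" if "w \<in> rcar W" for w
      using fun_cong[OF W(3), of w] that by (simp add: compose_def)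
    show "\<exists>!u. u \<in> Arr P W ?E \<and> Comp P W ?E X ?e u = r"
    proof (rule ex1I[of _ r])
      show "r \<in> Arr P W ?E \<and> Comp P W ?E X ?e r = r"
        using W(2) fg by (auto simp: Arr_PSh_iff compose_def fun_eq_iff PiE_def extensional_def)
      fix u assume u: "u \<in> Arr P W ?E \<and> Comp P W ?E X ?e u = r"
      have "u w = r w" if "w \<in> rcar W" for w
        using u PSh_ArrD(1)[of u W ?E w] that by (auto simp: compose_eq)
      then show "u = r"
        using u PSh_ArrD(2)[OF W(2)] PSh_ArrD(2)[of u W ?E] by (blast intro: extensionalityI)
    qed
  qed (use assms E e in \<open>simp_all del: PSh_simps(1)\<close>)
  then show ?thesis by blast
qed

text \<open>The usual set \<open>A\<close> of pairs is not a set of elements of \<open>'u\<close>,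
  unlike the carrier of an equalizer. The pullback is therefore its copy along the code
  \<open>c\<close>, and the projections go through the decoding \<open>d\<close>.\<close>

lemma pullback_exists:
  assumes X: "X \<in> Ob P" and Y: "Y \<in> Ob P" and Z: "Z \<in> Ob P"
    and f: "f \<in> Arr P X Z" and g: "g \<in> Arr P Y Z"
  shows "\<exists>Q p q. is_pullback P X Y Z f g Q p q"
proof -
  define A where "A = {(x, y). x \<in> rcar X \<and> y \<in> rcar Y \<and> f x = g y}"
  have A: "(x, y) \<in> A \<longleftrightarrow> x \<in> rcar X \<and> y \<in> rcar Y \<and> f x = g y" for x y
    by (simp add: A_def)
  let ?R = "\<lparr> rcar = A, ract = (\<lambda>(x, y) m. (ract X x m, ract Y y m)) \<rparr>"
  let ?Q = "encode_rset U ?R"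
  define c where "c = encode U A"
  define d where "d = the_inv_into A c"
  define p where "p = (\<lambda>z\<in>rcar ?Q. fst (d z))"
  define q where "q = (\<lambda>z\<in>rcar ?Q. snd (d z))"
  have "is_small U (rcar X \<times> rcar Y)" by (rule is_small_Times[OF universe]) (use X Y in simp_all)
  then have small: "is_small U A" by (rule is_small_subset[OF universe]) (auto simp: A)
  have act: "(ract X x m, ract Y y m) \<in> A" if "(x, y) \<in> A" "m \<in> carrier M" for x y m
    using that Ob_act(1)[OF X] Ob_act(1)[OF Y] PSh_ArrD(3)[OF f] PSh_ArrD(3)[OF g] by (simp add: A)
  then have Rset: "right_mset M ?R"
    using Ob_act(2,3)[OF X] Ob_act(2,3)[OF Y] unfolding right_mset_def
    by (clarsimp simp: Ball_def A)
  have Q: "?Q \<in> Ob P" using encode_rset_Ob[OF Rset _ universe] small by simp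
  have Qcar: "rcar ?Q = c ` A" by (simp add: rcar_encode_rset c_def)
  have Qact: "ract ?Q (c (x, y)) m = c (ract X x m, ract Y y m)" if "(x, y) \<in> A" for x y m
    using ract_encode_rset[of U ?R "(x, y)" m] small that by (simp add: c_def)
  have inj: "inj_on c A" unfolding c_def using encode(1)[OF small] .
  have d: "d (c a) = a" if "a \<in> A" for a
    unfolding d_def using the_inv_into_f_f[OF inj that] .
  have pq: "p (c (x, y)) = x" "q (c (x, y)) = y" if "(x, y) \<in> A" for x y
    using d[OF that] that unfolding p_def q_def Qcar by auto
  have pact: "p (ract ?Q z m) = ract X (p z) m \<and> q (ract ?Q z m) = ract Y (q z) m"
    if z: "z \<in> rcar ?Q" and m: "m \<in> carrier M" for z m
  proof -
    obtain x y where xy: "(x, y) \<in> A" "z = c (x, y)" using z unfolding Qcar by force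
    show ?thesis using Qact[OF xy(1)] pq[OF xy(1)] pq[OF act[OF xy(1) m]] xy(2) by simp
  qed
  have "p z \<in> rcar X \<and> q z \<in> rcar Y" if "z \<in> rcar ?Q" for z
    using that pq A unfolding Qcar by force
  then have pA: "p \<in> Arr P ?Q X" and qA: "q \<in> Arr P ?Q Y"
    unfolding Arr_PSh_iff using pact by (auto simp: p_def q_def)
  have comm: "f (p z) = g (q z)" if "z \<in> rcar ?Q" for z
    using that pq A unfolding Qcar by force
  have "is_pullback P X Y Z f g ?Q p q"
    unfolding is_pullback_def
  proof (intro conjI ballI impI)
    show "Comp P ?Q X Z f p = Comp P ?Q Y Z g q" using comm by (auto simp: compose_def fun_eq_iff)
  next
    fix W r s
    assume W: "W \<in> Ob P" "r \<in> Arr P W X" "s \<in> Arr P W Y" "Comp P W X Z f r = Comp P W Y Z g s"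
    have rs: "(r w, s w) \<in> A" if "w \<in> rcar W" for w
      using fun_cong[OF W(4), of w] that PSh_ArrD(1)[OF W(2)] PSh_ArrD(1)[OF W(3)]
      by (simp add: compose_def A)
    let ?u = "\<lambda>w\<in>rcar W. c (r w, s w)"
    show "\<exists>!u. u \<in> Arr P W ?Q \<and> Comp P W ?Q X p u = r \<and> Comp P W ?Q Y q u = s"
    proof (rule ex1I[of _ ?u], intro conjI)
      show "?u \<in> Arr P W ?Q"
        unfolding Arr_PSh_iff Qcar
        using rs Qact[OF rs] Ob_act(1)[OF W(1)] PSh_ArrD(3)[OF W(2)] PSh_ArrD(3)[OF W(3)] by simp
      show "Comp P W ?Q X p ?u = r" "Comp P W ?Q Y q ?u = s"
        using pq[OF rs] PSh_ArrD(2)[OF W(2)] PSh_ArrD(2)[OF W(3)]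
        by (auto simp: compose_def fun_eq_iff extensional_def)
    next
      fix u assume u: "u \<in> Arr P W ?Q \<and> Comp P W ?Q X p u = r \<and> Comp P W ?Q Y q u = s"
      show "u = ?u"
      proof (rule extensionalityI[of _ "rcar W"])
        show "u \<in> extensional (rcar W)" "?u \<in> extensional (rcar W)"
          using u PSh_ArrD(2) by auto
        fix w assume w: "w \<in> rcar W"
        then obtain x y where xy: "(x, y) \<in> A" "u w = c (x, y)"
          using u PSh_ArrD(1)[of u W ?Q w] unfolding Qcar by force
        have "r w = p (u w)" "s w = q (u w)" using u w by (auto simp: compose_def)
        then show "u w = ?u w" using xy pq[OF xy(1)] w by simp
      qed
    qed
  qed (use assms Q pA qA in \<open>simp_all del: PSh_simps(1)\<close>)
  then show ?thesis by blast
qed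

section \<open>Connected components\<close>

text \<open>\<open>equivclp\<close> is reflexive outside the carrier as well, so the relation is an
  equivalence on the whole type and facts about classes carry no membership conditions.\<close>

lemma component_rel_equiv: "equiv UNIV (component_rel M X)"
  unfolding component_rel_def
  by (rule equivI) (auto simp: refl_on_def sym_def trans_def intro: equivclp_sym equivclp_trans)

lemma component_class_eq_iff:
  "component_rel M X `` {x} = component_rel M X `` {y} \<longleftrightarrow> (x, y) \<in> component_rel M X"
  by (rule eq_equiv_class_iff[OF component_rel_equiv]) simp_all

lemma component_rel_refl: "(x, x) \<in> component_rel M X"
  unfolding component_class_eq_iff[symmetric] by simp

lemma component_rel_sym: "(x, y) \<in> component_rel M X \<Longrightarrow> (y, x) \<in> component_rel M X"
  unfolding component_class_eq_iff[symmetric] by simp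

lemma component_rel_trans:
  "(x, y) \<in> component_rel M X \<Longrightarrow> (y, z) \<in> component_rel M X \<Longrightarrow> (x, z) \<in> component_rel M X"
  unfolding component_class_eq_iff[symmetric] by simp

lemma component_rel_act:
  "x \<in> rcar X \<Longrightarrow> m \<in> carrier M \<Longrightarrow> (x, ract X x m) \<in> component_rel M X"
  unfolding component_rel_def by (auto intro!: r_into_equivclp)

text \<open>Induction along a zigzag of generators: an action by \<open>m\<close> neither leaves the
  carrier nor changes \<open>h\<close>. This is the universal property of the quotient. It is used
  with \<open>h\<close> the class of an image under an equivariant map, and with \<open>h\<close> a
  map into a trivial action.\<close>

lemma component_rel_invariant:
  assumes X: "X \<in> Ob P" and xy: "(x, y) \<in> component_rel M X" and x: "x \<in> rcar X"
    and h: "\<And>z m. z \<in> rcar X \<Longrightarrow> m \<in> carrier M \<Longrightarrow> h (ract X z m) = h z"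
  shows "y \<in> rcar X \<and> h x = h y"
proof -
  have "equivclp (\<lambda>x y. x \<in> rcar X \<and> (\<exists>m\<in>carrier M. y = ract X x m)) x y"
    using xy unfolding component_rel_def by simp
  then show ?thesis
    by (induction rule: equivclp_induct) (use x h Ob_act(1)[OF X] in auto)
qed

lemma component_rel_map:
  assumes X: "X \<in> Ob P" and f: "f \<in> Arr P X Y"
    and xy: "(x, y) \<in> component_rel M X" and x: "x \<in> rcar X"
  shows "(f x, f y) \<in> component_rel M Y"
proof -
  have "component_rel M Y `` {f x} = component_rel M Y `` {f y}"
  proof (rule conjunct2[OF component_rel_invariant[OF X xy x]])
    fix z m assume zm: "z \<in> rcar X" "m \<in> carrier M"
    then have "(f z, f (ract X z m)) \<in> component_rel M Y"
      using component_rel_act PSh_ArrD(1,3)[OF f] by metis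
    then show "component_rel M Y `` {f (ract X z m)} = component_rel M Y `` {f z}"
      unfolding component_class_eq_iff by (rule component_rel_sym)
  qed
  then show ?thesis unfolding component_class_eq_iff .
qed

text \<open>Every element of \<open>M\<close> is \<open>\<one> m\<close> for some \<open>m\<close>,
  hence one generator away from \<open>\<one>\<close>.\<close>

lemma component_rel_reg:
  assumes "r \<in> rcar reg" "s \<in> rcar reg"
  shows "(r, s) \<in> component_rel M reg"
proof -
  have one: "(code \<one>, t) \<in> component_rel M reg" if "t \<in> rcar reg" for t
    using that component_rel_act[OF one_reg] by (auto simp: rcar_reg ract_reg)
  show ?thesis
    using component_rel_trans[OF component_rel_sym[OF one[OF assms(1)]] one[OF assms(2)]] .
qed

text \<open>
  \<open>component_functor F q\<close>: \<open>F\<close> is a copy of the connected components functor whose quotient maps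
  are \<open>q X\<close>. This covers the three copies of \<open>C\<close> with different types of values: \<open>components M\<close>,
  the tensor product with \<open>1\<close>, and the inverse image of a point, which takes values in \<open>'u set\<close>.
\<close>

definition component_functor ::
  "(('u, 'm) rset, 'u \<Rightarrow> 'u, 'a set, 'a \<Rightarrow> 'a) ftor \<Rightarrow> (('u, 'm) rset \<Rightarrow> 'u \<Rightarrow> 'a) \<Rightarrow> bool" where
  "component_functor F q \<longleftrightarrow>
     (\<forall>X\<in>Ob P. fobj F X = q X ` rcar X \<and>
        (\<forall>x\<in>rcar X. \<forall>y\<in>rcar X. q X x = q X y \<longleftrightarrow> (x, y) \<in> component_rel M X)) \<and>
     (\<forall>X\<in>Ob P. \<forall>Y\<in>Ob P. \<forall>f\<in>Arr P X Y. fmap F X Y f \<in> extensional (fobj F X) \<and>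
        (\<forall>x\<in>rcar X. fmap F X Y f (q X x) = q Y (f x)))"

lemma component_functorD:
  assumes "component_functor F q" "X \<in> Ob P"
  shows "fobj F X = q X ` rcar X"
    "x \<in> rcar X \<Longrightarrow> y \<in> rcar X \<Longrightarrow> q X x = q X y \<longleftrightarrow> (x, y) \<in> component_rel M X"
    "Y \<in> Ob P \<Longrightarrow> f \<in> Arr P X Y \<Longrightarrow> fmap F X Y f \<in> extensional (fobj F X)"
    "Y \<in> Ob P \<Longrightarrow> f \<in> Arr P X Y \<Longrightarrow> x \<in> rcar X \<Longrightarrow> fmap F X Y f (q X x) = q Y (f x)"
  using assms unfolding component_functor_def by blast+

text \<open>The last premise offers the assumption \<open>q X x \<in> fobj F X\<close> because the
  instances define their arrow part by restriction to \<open>fobj F X\<close>, and evaluating it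
  needs this membership.\<close>

lemma component_functorI:
  assumes "\<And>X. X \<in> Ob P \<Longrightarrow> fobj F X = q X ` rcar X"
    and "\<And>X x y. \<lbrakk>X \<in> Ob P; x \<in> rcar X; y \<in> rcar X\<rbrakk> \<Longrightarrow>
      q X x = q X y \<longleftrightarrow> (x, y) \<in> component_rel M X"
    and "\<And>X Y f. \<lbrakk>X \<in> Ob P; Y \<in> Ob P; f \<in> Arr P X Y\<rbrakk> \<Longrightarrow>
      fmap F X Y f \<in> extensional (fobj F X)"
    and "\<And>X Y f x. \<lbrakk>X \<in> Ob P; Y \<in> Ob P; f \<in> Arr P X Y; x \<in> rcar X; q X x \<in> fobj F X\<rbrakk> \<Longrightarrow>
      fmap F X Y f (q X x) = q Y (f x)"
  shows "component_functor F q"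
proof -
  have "q X x \<in> fobj F X" if "X \<in> Ob P" "x \<in> rcar X" for X x
    using assms(1)[OF that(1)] that(2) by blast
  then show ?thesis
    unfolding component_functor_def using assms by (intro conjI ballI) metis+
qed

lemma component_functor_act:
  assumes F: "component_functor F q" and X: "X \<in> Ob P" and x: "x \<in> rcar X" and m: "m \<in> carrier M"
  shows "q X (ract X x m) = q X x"
proof -
  have "(x, ract X x m) \<in> component_rel M X" using component_rel_act x m .
  then show ?thesis using component_functorD(2)[OF F X x Ob_act(1)[OF X x m]] by simp
qed

lemma component_functor_reg:
  assumes F: "component_functor F q"
  shows "fobj F reg = {q reg (code \<one>)}"
proof -
  have "q reg r = q reg (code \<one>)" if "r \<in> rcar reg" for r
    using component_functorD(2)[OF F reg_Ob that one_reg] component_rel_reg[OF that one_reg] by simp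
  then have "q reg ` rcar reg = (\<lambda>_. q reg (code \<one>)) ` rcar reg" by (rule image_cong[OF refl])
  then show ?thesis using component_functorD(1)[OF F reg_Ob] image_constant[OF one_reg] by simp
qed

lemma component_functor_is_functor:
  assumes F: "component_functor F q"
  shows "is_functor P (set_cat U) F"
proof -
  note FO = component_functorD(1)[OF F] and Fe = component_functorD(3)[OF F]
    and Fm = component_functorD(4)[OF F]
  have FA: "fmap F X Y f \<in> fobj F X \<rightarrow>\<^sub>E fobj F Y"
    if "X \<in> Ob P" "Y \<in> Ob P" "f \<in> Arr P X Y" for X Y f
  proof -
    have "fmap F X Y f c \<in> fobj F Y" if "c \<in> fobj F X" for c
    proof -
      obtain x where "x \<in> rcar X" "c = q X x"
        using \<open>c \<in> fobj F X\<close> FO[OF \<open>X \<in> Ob P\<close>] by auto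
      then show ?thesis
        using Fm[OF \<open>X \<in> Ob P\<close> \<open>Y \<in> Ob P\<close> \<open>f \<in> Arr P X Y\<close>] PSh_ArrD(1)[OF \<open>f \<in> Arr P X Y\<close>]
          FO[OF \<open>Y \<in> Ob P\<close>] by simp
    qed
    then show ?thesis using Fe[OF that] by (simp add: PiE_def)
  qed
  have id: "fmap F X X (Idt P X) = (\<lambda>c\<in>fobj F X. c)" if X: "X \<in> Ob P" for X
    by (rule extensionalityI[of _ "fobj F X"])
       (use Fe[OF X X cat_Idt[OF category_PSh X]] Fm[OF X X cat_Idt[OF category_PSh X]] FO[OF X]
        in auto)
  have comp: "fmap F X Z (Comp P X Y Z g f) = compose (fobj F X) (fmap F Y Z g) (fmap F X Y f)"
    if X: "X \<in> Ob P" and Y: "Y \<in> Ob P" and Z: "Z \<in> Ob P" and f: "f \<in> Arr P X Y"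
      and g: "g \<in> Arr P Y Z" for X Y Z f g
  proof (rule extensionalityI[of _ "fobj F X"])
    note gf = cat_Comp[OF category_PSh X Y Z f g]
    show "fmap F X Z (Comp P X Y Z g f) \<in> extensional (fobj F X)" using Fe[OF X Z gf] .
    show "compose (fobj F X) (fmap F Y Z g) (fmap F X Y f) \<in> extensional (fobj F X)"
      by (simp add: compose_def)
    fix c assume c: "c \<in> fobj F X"
    then obtain x where x: "x \<in> rcar X" "c = q X x" using FO[OF X] by auto
    show "fmap F X Z (Comp P X Y Z g f) c =
        compose (fobj F X) (fmap F Y Z g) (fmap F X Y f) c"
      using Fm[OF X Z gf x(1)] Fm[OF X Y f x(1)] Fm[OF Y Z g PSh_ArrD(1)[OF f x(1)]] c x
      by (simp add: compose_eq)
  qed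
  have small: "is_small U (fobj F X)" if "X \<in> Ob P" for X
    unfolding FO[OF that] by (rule is_small_image[OF universe]) (use that in simp)
  show ?thesis
    unfolding is_functor_def using FA id comp small by (simp del: PSh_simps)
qed

text \<open>Related elements have related images, so saturating the image of a class adds nothing to
  the class of a single image. This turns the choice-free arrow parts of \<open>components\<close>
  and \<open>tensor\<close> into a formula on representatives.\<close>

lemma component_rel_saturate:
  assumes "X \<in> Ob P" "f \<in> Arr P X Y" "x \<in> rcar X"
  shows "component_rel M Y `` (f ` (component_rel M X `` {x})) = component_rel M Y `` {f x}"
proof -
  have "(f x, z) \<in> component_rel M Y"
    if "(x, y) \<in> component_rel M X" "(f y, z) \<in> component_rel M Y" for y z
    using component_rel_trans[OF component_rel_map[OF assms(1,2) that(1) assms(3)] that(2)] .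
  then show ?thesis using component_rel_refl[of x X] by fast
qed

section \<open>The three copies of the connected components functor\<close>

lemma components_component_functor:
  "component_functor (components M) (\<lambda>X x. component_rel M X `` {x})"
proof -
  have quot: "rcar X // component_rel M X = (\<lambda>x. component_rel M X `` {x}) ` rcar X" for X
    by (auto simp: quotient_def)
  show ?thesis
    by (rule component_functorI)
       (simp_all add: components_def quot component_class_eq_iff component_rel_saturate
         del: PSh_simps)
qed

text \<open>Over a one-point left \<open>M\<close>-set the generator
  \<open>(x m, b) \<sim> (x, m b)\<close> becomes \<open>x m \<sim> x\<close>. This is a generator
  of \<open>component_rel\<close> read backwards, hence the same equivalence closure.\<close>

lemma tensor_rel_terminal:
  "tensor_rel M terminal_lset X = {(u, v). (fst u, fst v) \<in> component_rel M X}"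
proof -
  let ?R = "\<lambda>x y. x \<in> rcar X \<and> (\<exists>m\<in>carrier M. y = ract X x m)"
  let ?S = "\<lambda>u v. \<exists>x\<in>rcar X. \<exists>m\<in>carrier M. u = (ract X x m, ()) \<and> v = (x, ())"
  have 1: "equivclp ?R (fst u) (fst v)" if "equivclp ?S u v" for u v
    using that
  proof (induction rule: equivclp_induct)
    case (step v w)
    then have "?R (fst v) (fst w) \<or> ?R (fst w) (fst v)" by auto
    then show ?case by (rule equivclp_into_equivclp[OF step.IH])
  qed simp
  have 2: "equivclp ?S (x, ()) (y, ())" if "equivclp ?R x y" for x y
    using that
  proof (induction rule: equivclp_induct)
    case (step y z)
    then have "?S (y, ()) (z, ()) \<or> ?S (z, ()) (y, ())" by auto
    then show ?case by (rule equivclp_into_equivclp[OF step.IH])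
  qed simp
  have iff: "equivclp ?S u v \<longleftrightarrow> equivclp ?R (fst u) (fst v)" for u v
    using 1[of u v] 2[of "fst u" "fst v"] by (cases u, cases v) auto
  have "tensor_rel M terminal_lset X = {(u, v). equivclp ?S u v}"
    unfolding tensor_rel_def by (simp add: terminal_lset_def)
  then show ?thesis unfolding iff component_rel_def by simp
qed

lemma tensor_terminal_component_functor:
  "component_functor (tensor M terminal_lset) (\<lambda>X x. component_rel M X `` {x} \<times> {()})"
proof -
  have cls: "tensor_rel M terminal_lset X `` {(x, b)} = component_rel M X `` {x} \<times> {()}" for X x b
    unfolding tensor_rel_terminal by auto
  have inj: "A \<times> {()} = B \<times> {()} \<longleftrightarrow> A = B" for A B :: "'u set"
    by auto
  have car: "lcar terminal_lset = {()}" by (simp add: terminal_lset_def)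
  have quot: "(rcar X \<times> {()}) // tensor_rel M terminal_lset X =
      (\<lambda>x. component_rel M X `` {x} \<times> {()}) ` rcar X" for X
    unfolding quotient_def by (auto simp: cls simp del: Image_singleton_iff)
  have map: "tensor_rel M terminal_lset Y `` (map_prod f id ` (component_rel M X `` {x} \<times> {()})) =
      component_rel M Y `` {f x} \<times> {()}"
    if "X \<in> Ob P" "f \<in> Arr P X Y" "x \<in> rcar X" for X Y f x
    unfolding component_rel_saturate[OF that, symmetric] tensor_rel_terminal by force
  show ?thesis
  proof (rule component_functorI)
    show "fobj (tensor M terminal_lset) X = (\<lambda>x. component_rel M X `` {x} \<times> {()}) ` rcar X" for X
      unfolding tensor_def by (simp add: car quot)
    show "fmap (tensor M terminal_lset) X Y f \<in> extensional (fobj (tensor M terminal_lset) X)"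
      for X Y f
      unfolding tensor_def by simp
    show "fmap (tensor M terminal_lset) X Y f (component_rel M X `` {x} \<times> {()}) =
        component_rel M Y `` {f x} \<times> {()}"
      if "X \<in> Ob P" "f \<in> Arr P X Y" "x \<in> rcar X"
        "component_rel M X `` {x} \<times> {()} \<in> fobj (tensor M terminal_lset) X" for X Y f x
      using that(4) map[OF that(1-3)] unfolding tensor_def by simp
  qed (simp add: inj component_class_eq_iff)
qed

text \<open>A point must take values in sets of elements of \<open>'u\<close>, so components are
  represented by chosen members instead of classes. Related elements satisfy the same defining
  predicate, and \<open>SOME\<close> then picks the same member for both.\<close>

definition component_rep :: "('u, 'm) rset \<Rightarrow> 'u \<Rightarrow> 'u" where
  "component_rep X x = (SOME y. (x, y) \<in> component_rel M X)"

definition component_reps :: "(('u, 'm) rset, 'u \<Rightarrow> 'u, 'u set, 'u \<Rightarrow> 'u) ftor" where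
  "component_reps =
     \<lparr> fobj = (\<lambda>X. component_rep X ` rcar X),
       fmap = (\<lambda>X Y f. \<lambda>r\<in>component_rep X ` rcar X. component_rep Y (f r)) \<rparr>"

lemma component_reps_component_functor: "component_functor component_reps component_rep"
proof -
  have rep: "(x, component_rep X x) \<in> component_rel M X" for X x
    unfolding component_rep_def by (rule someI[of _ x]) (rule component_rel_refl)
  have eq: "component_rep X x = component_rep X y \<longleftrightarrow> (x, y) \<in> component_rel M X" for X x y
  proof
    assume "component_rep X x = component_rep X y"
    then show "(x, y) \<in> component_rel M X"
      using rep component_rel_sym component_rel_trans by metis
  next
    assume "(x, y) \<in> component_rel M X"
    then have "(\<lambda>z. (x, z) \<in> component_rel M X) = (\<lambda>z. (y, z) \<in> component_rel M X)"
      using component_rel_sym component_rel_trans by metis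
    then show "component_rep X x = component_rep X y"
      unfolding component_rep_def by simp
  qed
  have map: "component_rep Y (f (component_rep X x)) = component_rep Y (f x)"
    if "X \<in> Ob P" "f \<in> Arr P X Y" "x \<in> rcar X" for X Y f x
    unfolding eq by (rule component_rel_sym) (rule component_rel_map[OF that(1,2) rep that(3)])
  show ?thesis
  proof (rule component_functorI)
    show "fmap component_reps X Y f (component_rep X x) = component_rep Y (f x)"
      if "X \<in> Ob P" "f \<in> Arr P X Y" "x \<in> rcar X" for X Y f x
      using map[OF that] that(3) unfolding component_reps_def by simp
  qed (simp_all add: component_reps_def eq del: PSh_simps)
qed

section \<open>Right collapsible monoids\<close>

text \<open>With one object, only the condition on parallel arrows has content. Passing to the
  opposite category reverses composition, which puts the equalizing element on the right.\<close>

lemma cofiltered_monoid_cat_iff: "cofiltered (monoid_cat M) \<longleftrightarrow> right_collapsible M"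
  using one_closed unfolding cofiltered_def filtered_def opposite_def monoid_cat_def
    right_collapsible_def by auto

text \<open>The relation \<open>x m = y m\<close> for some \<open>m\<close> contains the generators
  and is transitive: if \<open>x m = y m\<close> and \<open>y k = z k\<close>, choose
  \<open>a\<close> with \<open>m a = k a\<close>; then
  \<open>x m a = y m a = y k a = z k a = z m a\<close>.\<close>

lemma collapsible_component_rel:
  assumes rc: "right_collapsible M" and X: "X \<in> Ob P" and x: "x \<in> rcar X"
    and xy: "(x, y) \<in> component_rel M X"
  shows "\<exists>m\<in>carrier M. ract X x m = ract X y m"
proof -
  have "equivclp (\<lambda>x y. x \<in> rcar X \<and> (\<exists>m\<in>carrier M. y = ract X x m)) x y"
    using xy unfolding component_rel_def by simp
  then have "y \<in> rcar X \<and> (\<exists>m\<in>carrier M. ract X x m = ract X y m)"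
  proof (induction rule: equivclp_induct)
    case base
    show ?case using x by blast
  next
    case (step y z)
    then obtain m where y: "y \<in> rcar X" and m: "m \<in> carrier M" "ract X x m = ract X y m" by blast
    have act: "w \<in> rcar X \<Longrightarrow> n \<in> carrier M \<Longrightarrow> ract X w n \<in> rcar X"
      "w \<in> rcar X \<Longrightarrow> n \<in> carrier M \<Longrightarrow> k \<in> carrier M \<Longrightarrow> ract X (ract X w n) k = ract X w (n \<otimes> k)"
      for w n k using Ob_act[OF X] by blast+
    \<comment> \<open>A generator joins \<open>w\<close> to \<open>w n\<close>; collapsing the pair
      \<open>\<one>\<close>, \<open>n\<close> yields \<open>k = n k\<close>, so
      \<open>w k = w n k\<close>.\<close>
    have absorb: "\<exists>k\<in>carrier M. ract X w k = ract X (ract X w n) k"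
      if w: "w \<in> rcar X" and n: "n \<in> carrier M" for w n
    proof -
      obtain k where "k \<in> carrier M" "\<one> \<otimes> k = n \<otimes> k"
        using rc n one_closed unfolding right_collapsible_def by blast
      then show ?thesis using act(2)[OF w n] by (metis l_one)
    qed
    have z: "z \<in> rcar X" using step.hyps(2) y act(1) by blast
    obtain k where k: "k \<in> carrier M" "ract X y k = ract X z k"
      using step.hyps(2) absorb by metis
    obtain a where a: "a \<in> carrier M" "m \<otimes> a = k \<otimes> a"
      using rc m(1) k(1) unfolding right_collapsible_def by blast
    have "ract X x (m \<otimes> a) = ract X z (m \<otimes> a)"
      using act(2)[OF x m(1) a(1)] act(2)[OF y m(1) a(1)] act(2)[OF y k(1) a(1)]
        act(2)[OF z k(1) a(1)] m(2) k(2) a(2) by simp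
    then show ?case using z m(1) a(1) by blast
  qed
  then show ?thesis by blast
qed

text \<open>A right multiple of an element that equalizes a pair still equalizes it, and
  \<open>m a = k a\<close> is a common right multiple of the element for \<open>I\<close> and the
  element for the new index.\<close>

lemma collapsible_finite:
  assumes rc: "right_collapsible M" and "finite I"
    and "\<And>i. i \<in> I \<Longrightarrow> X i \<in> Ob P \<and> x i \<in> rcar (X i) \<and> y i \<in> rcar (X i) \<and>
      (x i, y i) \<in> component_rel M (X i)"
  shows "\<exists>m\<in>carrier M. \<forall>i\<in>I. ract (X i) (x i) m = ract (X i) (y i) m"
  using assms(2,3)
proof (induction I rule: finite_induct)
  case (insert i I)
  then obtain m where m: "m \<in> carrier M" "\<And>j. j \<in> I \<Longrightarrow> ract (X j) (x j) m = ract (X j) (y j) m"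
    by blast
  obtain k where k: "k \<in> carrier M" "ract (X i) (x i) k = ract (X i) (y i) k"
    using collapsible_component_rel[OF rc] insert.prems by blast
  obtain a where a: "a \<in> carrier M" "m \<otimes> a = k \<otimes> a"
    using rc m(1) k(1) unfolding right_collapsible_def by blast
  have "ract (X j) (x j) (m \<otimes> a) = ract (X j) (y j) (m \<otimes> a)" if "j \<in> insert i I" for j
  proof -
    have j: "X j \<in> Ob P" "x j \<in> rcar (X j)" "y j \<in> rcar (X j)" using insert.prems that by blast+
    show ?thesis
    proof (cases "j = i")
      case True
      then show ?thesis
        using Ob_act(3)[OF j(1,2) k(1) a(1)] Ob_act(3)[OF j(1,3) k(1) a(1)] k(2) a(2) by simp
    next
      case False
      then show ?thesis
        using Ob_act(3)[OF j(1,2) m(1) a(1)] Ob_act(3)[OF j(1,3) m(1) a(1)] m(2)[of j] that by simp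
    qed
  qed
  then show ?case using m(1) a(1) by blast
qed (use one_closed in blast)

text \<open>
  Elements in the same component become equal after multiplication by some \<open>m\<close>, and one \<open>m\<close> serves
  finitely many pairs. This lifts compatible families of components to compatible families of
  elements, and makes elements of the limit equal whose projections share their components.
\<close>

lemma component_functor_preserves_finite_limits:
  assumes F: "component_functor F q" and rc: "right_collapsible M"
  shows "preserves_finite_limits P (set_cat U) F"
  unfolding preserves_finite_limits_def
proof (intro allI impI, elim conjE)
  fix J :: "(nat, nat) cat" and E L p
  assume fin: "finite (Ob J)" "\<forall>i\<in>Ob J. \<forall>j\<in>Ob J. finite (Arr J i j)"
    and E: "is_functor J P E" and lim: "is_limit J P E L p"
  have cone: "is_cone J P E L p" using lim unfolding is_limit_def by blast
  then have L: "L \<in> Ob P" and pA: "\<And>i. i \<in> Ob J \<Longrightarrow> p i \<in> Arr P L (fobj E i)"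
    and pc: "\<And>i j a. i \<in> Ob J \<Longrightarrow> j \<in> Ob J \<Longrightarrow> a \<in> Arr J i j \<Longrightarrow>
      compose (rcar L) (fmap E i j a) (p i) = p j"
    unfolding is_cone_def PSh_simps(3) by blast+
  note EO = functor_Ob[OF E] and EA = functor_Arr[OF E]
  have pE: "fmap E i j a (p i l) = p j l"
    if "i \<in> Ob J" "j \<in> Ob J" "a \<in> Arr J i j" "l \<in> rcar L" for i j a l
    using pc[OF that(1-3)] compose_eq[OF that(4)] by metis
  show "is_limit J (set_cat U) (comp_functor F E) (fobj F L) (\<lambda>i. fmap F L (fobj E i) (p i))"
  proof (rule set_limitI)
    show "is_cone J (set_cat U) (comp_functor F E) (fobj F L) (\<lambda>i. fmap F L (fobj E i) (p i))"
      using cone_image[OF component_functor_is_functor[OF F] E cone] .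
  next
    fix c
    assume c: "\<And>i. i \<in> Ob J \<Longrightarrow> c i \<in> fobj (comp_functor F E) i"
      and cc: "\<And>i j a. \<lbrakk>i \<in> Ob J; j \<in> Ob J; a \<in> Arr J i j\<rbrakk> \<Longrightarrow>
        fmap (comp_functor F E) i j a (c i) = c j"
    have "\<exists>y\<in>rcar (fobj E i). c i = q (fobj E i) y" if "i \<in> Ob J" for i
      using c[OF that] component_functorD(1)[OF F EO[OF that]] unfolding comp_functor_def by auto
    then obtain y where y: "\<And>i. i \<in> Ob J \<Longrightarrow> y i \<in> rcar (fobj E i)"
      and cy: "\<And>i. i \<in> Ob J \<Longrightarrow> c i = q (fobj E i) (y i)" by metis
    \<comment> \<open>One pair for each arrow \<open>a : i \<rightarrow> j\<close> of
      \<open>J\<close>: the image of the representative \<open>y i\<close> under \<open>a\<close>,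
      and the representative \<open>y j\<close>. Finiteness of \<open>J\<close> makes these finitely
      many.\<close>
    let ?A = "SIGMA i:Ob J. SIGMA j:Ob J. Arr J i j"
    have yy: "(fmap E i j a (y i), y j) \<in> component_rel M (fobj E j)"
      if "i \<in> Ob J" "j \<in> Ob J" "a \<in> Arr J i j" for i j a
    proof -
      have "q (fobj E j) (fmap E i j a (y i)) = q (fobj E j) (y j)"
        using cc[OF that] cy[OF that(1)] cy[OF that(2)] y[OF that(1)]
          component_functorD(4)[OF F EO[OF that(1)] EO[OF that(2)] EA[OF that(1,2,3)]]
        unfolding comp_functor_def by simp
      then show ?thesis
        using component_functorD(2)[OF F EO[OF that(2)]] PSh_ArrD(1)[OF EA[OF that]] y that by blast
    qed
    have "\<exists>m\<in>carrier M. \<forall>t\<in>?A.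
        ract (fobj E (fst (snd t))) (fmap E (fst t) (fst (snd t)) (snd (snd t)) (y (fst t))) m =
        ract (fobj E (fst (snd t))) (y (fst (snd t))) m"
    proof (rule collapsible_finite[OF rc])
      show "finite ?A" using fin by (intro finite_SigmaI) auto
    next
      fix t assume "t \<in> ?A"
      then have t: "fst t \<in> Ob J" "fst (snd t) \<in> Ob J" "snd (snd t) \<in> Arr J (fst t) (fst (snd t))"
        by auto
      show "fobj E (fst (snd t)) \<in> Ob P \<and>
        fmap E (fst t) (fst (snd t)) (snd (snd t)) (y (fst t)) \<in> rcar (fobj E (fst (snd t))) \<and>
        y (fst (snd t)) \<in> rcar (fobj E (fst (snd t))) \<and>
        (fmap E (fst t) (fst (snd t)) (snd (snd t)) (y (fst t)), y (fst (snd t)))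
          \<in> component_rel M (fobj E (fst (snd t)))"
        using EO[OF t(2)] PSh_ArrD(1)[OF EA[OF t] y[OF t(1)]] y[OF t(2)] yy[OF t] by blast
    qed
    then obtain m where m: "m \<in> carrier M" and my: "\<And>i j a. i \<in> Ob J \<Longrightarrow> j \<in> Ob J \<Longrightarrow>
        a \<in> Arr J i j \<Longrightarrow> ract (fobj E j) (fmap E i j a (y i)) m = ract (fobj E j) (y j) m"
      by force
    let ?x = "\<lambda>i. ract (fobj E i) (y i) m"
    have "\<exists>!l. l \<in> rcar L \<and> (\<forall>i\<in>Ob J. p i l = ?x i)"
    proof (rule limit_elements[OF E lim])
      show "?x i \<in> rcar (fobj E i)" if "i \<in> Ob J" for i using Ob_act(1)[OF EO[OF that] y[OF that] m] .
      show "fmap E i j a (?x i) = ?x j" if "i \<in> Ob J" "j \<in> Ob J" "a \<in> Arr J i j" for i j a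
        using PSh_ArrD(3)[OF EA[OF that] y[OF that(1)] m] my[OF that] by simp
    qed
    then obtain l where l: "l \<in> rcar L" and pl: "\<And>i. i \<in> Ob J \<Longrightarrow> p i l = ?x i" by blast
    have Fp: "fmap F L (fobj E i) (p i) (q L k) = q (fobj E i) (p i k)"
      if "i \<in> Ob J" "k \<in> rcar L" for i k
      using component_functorD(4)[OF F L EO[OF that(1)] pA[OF that(1)] that(2)] .
    show "\<exists>!d. d \<in> fobj F L \<and> (\<forall>i\<in>Ob J. fmap F L (fobj E i) (p i) d = c i)"
    proof (rule ex1I[of _ "q L l"], intro conjI ballI)
      show "q L l \<in> fobj F L" using l component_functorD(1)[OF F L] by blast
      show "fmap F L (fobj E i) (p i) (q L l) = c i" if "i \<in> Ob J" for i
        using Fp[OF that l] pl[OF that] component_functor_act[OF F EO[OF that] y[OF that] m]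
          cy[OF that] by simp
    next
      fix d assume d: "d \<in> fobj F L \<and> (\<forall>i\<in>Ob J. fmap F L (fobj E i) (p i) d = c i)"
      then obtain k where k: "k \<in> rcar L" "d = q L k" using component_functorD(1)[OF F L] by blast
      have "\<exists>n\<in>carrier M. \<forall>i\<in>Ob J. ract (fobj E i) (p i k) n = ract (fobj E i) (p i l) n"
      proof (rule collapsible_finite[OF rc fin(1)])
        fix i assume i: "i \<in> Ob J"
        have "q (fobj E i) (p i k) = q (fobj E i) (p i l)"
          using Fp[OF i k(1)] Fp[OF i l] d k(2) i pl[OF i] cy[OF i]
            component_functor_act[OF F EO[OF i] y[OF i] m] by simp
        moreover have "p i k \<in> rcar (fobj E i)" "p i l \<in> rcar (fobj E i)"
          using PSh_ArrD(1)[OF pA[OF i]] k(1) l by blast+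
        ultimately show "fobj E i \<in> Ob P \<and> p i k \<in> rcar (fobj E i) \<and> p i l \<in> rcar (fobj E i) \<and>
            (p i k, p i l) \<in> component_rel M (fobj E i)"
          using component_functorD(2)[OF F EO[OF i]] EO[OF i] by blast
      qed
      then obtain n where n: "n \<in> carrier M"
        and nk: "\<And>i. i \<in> Ob J \<Longrightarrow> ract (fobj E i) (p i k) n = ract (fobj E i) (p i l) n" by blast
      have kn: "ract L k n \<in> rcar L" and ln: "ract L l n \<in> rcar L"
        using Ob_act(1)[OF L _ n] k(1) l by blast+
      \<comment> \<open>The family of projections of \<open>l n\<close> is compatible, and both
        \<open>k n\<close> and \<open>l n\<close> project to it. Hence they coincide, and
        \<open>k\<close> and \<open>l\<close> share a component.\<close>
      have "\<exists>!z. z \<in> rcar L \<and> (\<forall>i\<in>Ob J. p i z = p i (ract L l n))"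
        by (rule limit_elements[OF E lim]) (use PSh_ArrD(1)[OF pA] ln pE in blast)+
      moreover have "p i (ract L k n) = p i (ract L l n)" if "i \<in> Ob J" for i
        using PSh_ArrD(3)[OF pA[OF that] _ n] k(1) l nk[OF that] by simp
      ultimately have "ract L k n = ract L l n" using kn ln by blast
      then show "d = q L l"
        using component_functor_act[OF F L k(1) n] component_functor_act[OF F L l n] k(2) by simp
    qed
  qed
qed

section \<open>Right collapsibility from preservation of equalizers or pullbacks\<close>

text \<open>The two multiplications induce the same map on the singleton \<open>F M\<close>, so its
  element \<open>t\<close> lies in the equalizer of the images. \<open>F\<close> is kept general
  because the result also serves for the inverse image of a terminal point, which is not known in
  advance to compute components.\<close>

lemma collapsible_if_preserves_equalizers:
  assumes F: "is_functor P (set_cat U) F" and eqs: "preserves_equalizers P (set_cat U) F"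
    and t: "fobj F reg = {t}"
    and empty: "\<And>X. X \<in> Ob P \<Longrightarrow> rcar X = {} \<Longrightarrow> fobj F X = {}"
  shows "right_collapsible M"
  unfolding right_collapsible_def
proof (intro ballI)
  fix m1 m2 assume m: "m1 \<in> carrier M" "m2 \<in> carrier M"
  have code: "code m1 \<in> rcar reg" "code m2 \<in> rcar reg" using m by (simp_all add: rcar_reg)
  let ?f = "point_map reg (code m1)" and ?g = "point_map reg (code m2)"
  note f = point_map_Arr[OF reg_Ob code(1)] and g = point_map_Arr[OF reg_Ob code(2)]
  obtain E e where E: "is_equalizer P reg reg ?f ?g E e"
    using equalizer_exists[OF reg_Ob reg_Ob f g] by blast
  then have EO: "E \<in> Ob P" and e: "e \<in> Arr P E reg"
    and comm: "compose (rcar E) ?f e = compose (rcar E) ?g e"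
    unfolding is_equalizer_def PSh_simps(3) by blast+
  have "fmap F reg reg ?f t \<in> fobj F reg" "fmap F reg reg ?g t \<in> fobj F reg"
    using functor_Arr[OF F reg_Ob reg_Ob f] functor_Arr[OF F reg_Ob reg_Ob g] t by auto
  then have "fmap F reg reg ?f t = fmap F reg reg ?g t" using t by simp
  moreover have "is_equalizer (set_cat U) (fobj F reg) (fobj F reg) (fmap F reg reg ?f)
      (fmap F reg reg ?g) (fobj F E) (fmap F E reg e)"
    using eqs E unfolding preserves_equalizers_def by blast
  ultimately have "fobj F E \<noteq> {}"
    using set_equalizer_elements[OF universe] t by (metis empty_iff singletonI)
  then obtain z where z: "z \<in> rcar E" using empty[OF EO] by blast
  then have "e z \<in> rcar reg" using PSh_ArrD(1)[OF e] by blast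
  then obtain n where n: "n \<in> carrier M" "e z = code n" by (auto simp: rcar_reg)
  have "?f (e z) = ?g (e z)" using comm compose_eq[OF z] by metis
  then have "code (m1 \<otimes> n) = code (m2 \<otimes> n)"
    using n m by (simp add: point_map_code ract_reg)
  then show "\<exists>m\<in>carrier M. m1 \<otimes> m = m2 \<otimes> m" using inj_onD[OF inj_code] n m by blast
qed

text \<open>
  \<open>C\<close> preserves \<open>M \<times> M\<close> as a pullback over \<open>1\<close>, so all maps \<open>M \<rightarrow> M \<times> M\<close> agree on components, and
  hence the pullback of \<open>(m1, m2)\<close> along the diagonal is nonempty.
\<close>

lemma collapsible_if_preserves_pullbacks:
  assumes F: "component_functor F q" and pbs: "preserves_pullbacks P (set_cat U) F"
  shows "right_collapsible M"
  unfolding right_collapsible_def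
proof (intro ballI)
  fix m1 m2 assume m: "m1 \<in> carrier M" "m2 \<in> carrier M"
  have code: "code m1 \<in> rcar reg" "code m2 \<in> rcar reg" using m by (simp_all add: rcar_reg)
  note a1 = point_map_Arr[OF reg_Ob code(1)] and a2 = point_map_Arr[OF reg_Ob code(2)]
    and a0 = point_map_Arr[OF reg_Ob one_reg]
  define T :: "('u, 'm) rset" where "T = \<lparr> rcar = {undefined}, ract = (\<lambda>x m. x) \<rparr>"
  have T: "T \<in> Ob P" unfolding T_def by (rule terminal_mset)
  have "undefined \<in> rcar T" by (simp add: T_def)
  from point_map_Arr[OF T this] obtain b where b: "b \<in> Arr P reg T" by blast
  have bT: "compose (rcar reg) b u = compose (rcar reg) b v"
    if "u \<in> Arr P reg reg" "v \<in> Arr P reg reg" for u v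
    using PSh_ArrD(1)[OF that(1)] PSh_ArrD(1)[OF that(2)] PSh_ArrD(1)[OF b]
    by (auto simp: compose_def fun_eq_iff T_def)
  \<comment> \<open>\<open>S\<close> is \<open>M \<times> M\<close>: over the terminal
    \<open>T\<close> every pair of maps into \<open>M\<close> is compatible.\<close>
  obtain S p r where S: "is_pullback P reg reg T b b S p r"
    using pullback_exists[OF reg_Ob reg_Ob T b b] by blast
  then have SO: "S \<in> Ob P" and p: "p \<in> Arr P S reg" and r: "r \<in> Arr P S reg"
    unfolding is_pullback_def by blast+
  have pair: "\<exists>u. u \<in> Arr P reg S \<and> compose (rcar reg) p u = v \<and> compose (rcar reg) r u = w"
    if "v \<in> Arr P reg reg" "w \<in> Arr P reg reg" for v w
    using S bT[OF that] that reg_Ob unfolding is_pullback_def PSh_simps(3) by blast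
  \<comment> \<open>\<open>u\<close> pairs the left multiplications by \<open>m1\<close> and
    \<open>m2\<close>. The map \<open>d\<close> obtained next pairs left multiplication by
    \<open>\<one>\<close> with itself, so it is the diagonal.\<close>
  obtain u where u: "u \<in> Arr P reg S" "compose (rcar reg) p u = point_map reg (code m1)"
    "compose (rcar reg) r u = point_map reg (code m2)" using pair[OF a1 a2] by blast
  obtain d where d: "d \<in> Arr P reg S" "compose (rcar reg) p d = point_map reg (code \<one>)"
    "compose (rcar reg) r d = point_map reg (code \<one>)" using pair[OF a0 a0] by blast
  obtain Q v w where Q: "is_pullback P reg reg S u d Q v w"
    using pullback_exists[OF reg_Ob reg_Ob SO u(1) d(1)] by blast
  then have QO: "Q \<in> Ob P" and v: "v \<in> Arr P Q reg" and w: "w \<in> Arr P Q reg"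
    and comm: "compose (rcar Q) u v = compose (rcar Q) d w"
    unfolding is_pullback_def PSh_simps(3) by blast+
  have us: "u (code \<one>) \<in> rcar S" and ds: "d (code \<one>) \<in> rcar S"
    using PSh_ArrD(1)[OF u(1) one_reg] PSh_ArrD(1)[OF d(1) one_reg] .
  let ?t = "q reg (code \<one>)"
  have q_reg: "q reg s = ?t" if "s \<in> rcar reg" for s
    using component_functorD(1)[OF F reg_Ob] component_functor_reg[OF F] that by blast
  have FS: "is_pullback (set_cat U) (fobj F reg) (fobj F reg) (fobj F T) (fmap F reg T b)
      (fmap F reg T b) (fobj F S) (fmap F S reg p) (fmap F S reg r)"
    using pbs S unfolding preserves_pullbacks_def by blast
  \<comment> \<open>Both projections of every component of \<open>S\<close> equal \<open>?t\<close>,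
    so the uniqueness half of the preserved pullback leaves \<open>S\<close> only one
    component.\<close>
  have "\<exists>!z. z \<in> fobj F S \<and> fmap F S reg p z = ?t \<and> fmap F S reg r z = ?t"
    by (rule set_pullback_elements[OF universe FS]) (simp_all add: component_functor_reg[OF F])
  moreover have "q S s \<in> fobj F S \<and> fmap F S reg p (q S s) = ?t \<and> fmap F S reg r (q S s) = ?t"
    if s: "s \<in> rcar S" for s
    using component_functorD(1)[OF F SO] component_functorD(4)[OF F SO reg_Ob p s]
      component_functorD(4)[OF F SO reg_Ob r s] q_reg[OF PSh_ArrD(1)[OF p s]]
      q_reg[OF PSh_ArrD(1)[OF r s]] s by simp
  ultimately have "q S (u (code \<one>)) = q S (d (code \<one>))" using us ds by blast
  then have eq: "fmap F reg S u ?t = fmap F reg S d ?t"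
    using component_functorD(4)[OF F reg_Ob SO u(1) one_reg]
      component_functorD(4)[OF F reg_Ob SO d(1) one_reg] by simp
  have FQ: "is_pullback (set_cat U) (fobj F reg) (fobj F reg) (fobj F S) (fmap F reg S u)
      (fmap F reg S d) (fobj F Q) (fmap F Q reg v) (fmap F Q reg w)"
    using pbs Q unfolding preserves_pullbacks_def by blast
  \<comment> \<open>Here the existence half is what counts: it gives an element of
    \<open>F Q\<close>, hence one of \<open>Q\<close>.\<close>
  have "\<exists>!z. z \<in> fobj F Q \<and> fmap F Q reg v z = ?t \<and> fmap F Q reg w z = ?t"
    by (rule set_pullback_elements[OF universe FQ]) (simp_all add: component_functor_reg[OF F] eq)
  then obtain z where z: "z \<in> rcar Q" using component_functorD(1)[OF F QO] by blast
  have "v z \<in> rcar reg" "w z \<in> rcar reg" using PSh_ArrD(1)[OF v z] PSh_ArrD(1)[OF w z] .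
  then obtain n k where n: "n \<in> carrier M" "v z = code n" and k: "k \<in> carrier M" "w z = code k"
    by (auto simp: rcar_reg)
  have uv: "u (v z) = d (w z)" using comm compose_eq[OF z] by metis
  have nk: "code n \<in> rcar reg" "code k \<in> rcar reg" using n k by (simp_all add: rcar_reg)
  \<comment> \<open>In coordinates, \<open>u (v z) = d (w z)\<close> says \<open>m1 n = k\<close>
    and \<open>m2 n = k\<close>.\<close>
  have "p (u (code n)) = code (m1 \<otimes> n)" "r (u (code n)) = code (m2 \<otimes> n)"
    using fun_cong[OF u(2), of "code n"] fun_cong[OF u(3), of "code n"] nk n m
    by (simp_all add: compose_eq point_map_code ract_reg)
  moreover have "p (d (code k)) = code k" "r (d (code k)) = code k"
    using fun_cong[OF d(2), of "code k"] fun_cong[OF d(3), of "code k"] nk k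
    by (simp_all add: compose_eq point_map_code ract_reg)
  ultimately have "code (m1 \<otimes> n) = code (m2 \<otimes> n)" using uv n(2) k(2) by simp
  then show "\<exists>m\<in>carrier M. m1 \<otimes> m = m2 \<otimes> m" using inj_onD[OF inj_code] n(1) m by blast
qed

lemma component_functor_limits_iff:
  assumes F: "component_functor F q"
  shows "preserves_finite_limits P (set_cat U) F \<longleftrightarrow> right_collapsible M"
    and "preserves_equalizers P (set_cat U) F \<longleftrightarrow> right_collapsible M"
    and "preserves_pullbacks P (set_cat U) F \<longleftrightarrow> right_collapsible M"
proof -
  note FF = component_functor_is_functor[OF F]
  have "preserves_finite_limits P (set_cat U) F" if "right_collapsible M"
    using component_functor_preserves_finite_limits[OF F that] .
  moreover have "preserves_equalizers P (set_cat U) F" if "preserves_finite_limits P (set_cat U) F"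
    using preserves_equalizers_if_finite_limits[OF category_PSh category_set_cat FF that] .
  moreover have "preserves_pullbacks P (set_cat U) F" if "preserves_finite_limits P (set_cat U) F"
    using preserves_pullbacks_if_finite_limits[OF category_PSh category_set_cat FF that] .
  moreover have "right_collapsible M" if "preserves_pullbacks P (set_cat U) F"
    using collapsible_if_preserves_pullbacks[OF F that] .
  moreover have "right_collapsible M" if "preserves_equalizers P (set_cat U) F"
    using collapsible_if_preserves_equalizers[OF FF that component_functor_reg[OF F]]
      component_functorD(1)[OF F] by blast
  ultimately show "preserves_finite_limits P (set_cat U) F \<longleftrightarrow> right_collapsible M"
    "preserves_equalizers P (set_cat U) F \<longleftrightarrow> right_collapsible M"
    "preserves_pullbacks P (set_cat U) F \<longleftrightarrow> right_collapsible M" by blast+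
qed

section \<open>Points\<close>

definition trivial_action :: "('u set, 'u \<Rightarrow> 'u, ('u, 'm) rset, 'u \<Rightarrow> 'u) ftor" where
  "trivial_action = \<lparr> fobj = (\<lambda>S. \<lparr> rcar = S, ract = (\<lambda>x m. x) \<rparr>), fmap = (\<lambda>S T f. f) \<rparr>"

lemma trivial_action_is_functor: "is_functor (set_cat U) P trivial_action"
  unfolding is_functor_def trivial_action_def by (auto simp: right_mset_def Arr_PSh_iff)

text \<open>Equivariant maps into a trivial action are the maps invariant under every
  \<open>m\<close>, hence those constant on components. Transposition is precomposition with the
  quotient map \<open>q X\<close>.\<close>

lemma component_functor_left_adjoint:
  assumes F: "component_functor F q"
  shows "left_adjoint P (set_cat U) F trivial_action"
proof -
  note FF = component_functor_is_functor[OF F] and FO = component_functorD(1)[OF F]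
  define \<phi> where "\<phi> X Y g = (\<lambda>x\<in>rcar X. g (q X x))" for X and Y :: "'u set" and g :: "'u \<Rightarrow> 'u"
  have arr: "h \<in> Arr P X (fobj trivial_action Y) \<longleftrightarrow>
      h \<in> rcar X \<rightarrow>\<^sub>E Y \<and> (\<forall>x\<in>rcar X. \<forall>m\<in>carrier M. h (ract X x m) = h x)" for h X Y
    unfolding Arr_PSh_iff trivial_action_def by simp
  have bij: "bij_betw (\<phi> X Y) (Arr (set_cat U) (fobj F X) Y) (Arr P X (fobj trivial_action Y))"
    if X: "X \<in> Ob P" for X Y
    unfolding bij_betw_def
  proof (intro conjI inj_onI equalityI subsetI)
    fix g g' assume g: "g \<in> Arr (set_cat U) (fobj F X) Y" "g' \<in> Arr (set_cat U) (fobj F X) Y"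
      and eq: "\<phi> X Y g = \<phi> X Y g'"
    have "g (q X x) = g' (q X x)" if "x \<in> rcar X" for x
      using fun_cong[OF eq, of x] that by (simp add: \<phi>_def)
    then show "g = g'" using g FO[OF X] by (intro PiE_ext[of g "fobj F X" "\<lambda>_. Y" g']) auto
  next
    fix h assume "h \<in> \<phi> X Y ` Arr (set_cat U) (fobj F X) Y"
    then obtain g where g: "g \<in> fobj F X \<rightarrow>\<^sub>E Y" "h = \<phi> X Y g" by auto
    then show "h \<in> Arr P X (fobj trivial_action Y)"
      unfolding arr \<phi>_def using Ob_act(1)[OF X] component_functor_act[OF F X] FO[OF X] by auto
  next
    fix h assume h: "h \<in> Arr P X (fobj trivial_action Y)"
    \<comment> \<open>The value of \<open>h\<close> at any representative of \<open>c\<close>;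
      invariance of \<open>h\<close> makes the choice immaterial.\<close>
    let ?g = "\<lambda>c\<in>fobj F X. h (inv_into (rcar X) (q X) c)"
    have g: "?g (q X x) = h x" if x: "x \<in> rcar X" for x
    proof -
      let ?y = "inv_into (rcar X) (q X) (q X x)"
      have y: "?y \<in> rcar X" "q X ?y = q X x" using x by (auto intro: inv_into_into f_inv_into_f)
      then have "(?y, x) \<in> component_rel M X" using component_functorD(2)[OF F X y(1) x] by simp
      then have "h ?y = h x" using component_rel_invariant[OF X _ y(1)] h unfolding arr by blast
      then show ?thesis using x FO[OF X] by simp
    qed
    have "h = \<phi> X Y ?g"
      using h g unfolding arr \<phi>_def by (auto simp: fun_eq_iff PiE_def extensional_def)
    moreover have "?g \<in> fobj F X \<rightarrow>\<^sub>E Y" using g h unfolding arr FO[OF X] by auto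
    ultimately show "h \<in> \<phi> X Y ` Arr (set_cat U) (fobj F X) Y" by simp
  qed
  have nat: "\<phi> X' Y' (compose (fobj F X') k (compose (fobj F X') g (fmap F X' X h))) =
      compose (rcar X') (fmap trivial_action Y Y' k) (compose (rcar X') (\<phi> X Y g) h)"
    if X: "X \<in> Ob P" and X': "X' \<in> Ob P" and h: "h \<in> Arr P X' X" for X X' Y Y' h g k
  proof (rule extensionalityI[of _ "rcar X'"])
    fix x assume x: "x \<in> rcar X'"
    then have "q X' x \<in> fobj F X'" using FO[OF X'] by simp
    then show "\<phi> X' Y' (compose (fobj F X') k (compose (fobj F X') g (fmap F X' X h))) x =
        compose (rcar X') (fmap trivial_action Y Y' k) (compose (rcar X') (\<phi> X Y g) h) x"
      using x component_functorD(4)[OF F X' X h x] PSh_ArrD(1)[OF h x]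
      by (simp add: \<phi>_def compose_eq trivial_action_def)
  qed (simp_all add: \<phi>_def compose_def)
  show ?thesis
    unfolding left_adjoint_def
  proof (intro conjI exI[of _ \<phi>] ballI)
    show "\<phi> X' Y' (Comp (set_cat U) (fobj F X') Y Y' k
        (Comp (set_cat U) (fobj F X') (fobj F X) Y g (fmap F X' X h))) =
      Comp P X' (fobj trivial_action Y) (fobj trivial_action Y') (fmap trivial_action Y Y' k)
        (Comp P X' X (fobj trivial_action Y) (\<phi> X Y g) h)"
      if "X \<in> Ob P" "X' \<in> Ob P" "h \<in> Arr P X' X" for X X' Y Y' h g k
      using nat[OF that] by simp
  qed (fact FF trivial_action_is_functor | rule bij, assumption)+
qed

text \<open>
  By adjunction and evaluation at \<open>code \<one>\<close>, a transformation \<open>H \<Rightarrow> F\<close> at \<open>X\<close> is determined by its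
  composites with the maps \<open>H M \<rightarrow> H X\<close> given by the elements of \<open>X\<close>; by naturality these
  composites factor through \<open>F M\<close>, a singleton.
\<close>

lemma unique_nat_trans_component_functor:
  assumes adj: "left_adjoint P (set_cat U) H G" and F: "component_functor F q"
  shows "\<exists>!\<alpha>. \<alpha> \<in> nat_trans P (set_cat U) H F"
proof -
  have H: "is_functor P (set_cat U) H" and G: "is_functor (set_cat U) P G"
    using adj unfolding left_adjoint_def by blast+
  note FF = component_functor_is_functor[OF F]
  note FO = functor_Ob[OF FF] and HO = functor_Ob[OF H] and GO = functor_Ob[OF G]
  note FA = functor_Arr[OF FF, unfolded set_cat_simps] and HA = functor_Arr[OF H, unfolded set_cat_simps]
  obtain \<phi> where bij: "\<And>X Y. X \<in> Ob P \<Longrightarrow> Y \<in> Ob (set_cat U) \<Longrightarrow>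
      bij_betw (\<phi> X Y) (fobj H X \<rightarrow>\<^sub>E Y) (Arr P X (fobj G Y))"
    and natl: "\<And>X X' Y h g. \<lbrakk>X \<in> Ob P; X' \<in> Ob P; Y \<in> Ob (set_cat U); h \<in> Arr P X' X;
        g \<in> fobj H X \<rightarrow>\<^sub>E Y\<rbrakk> \<Longrightarrow>
      \<phi> X' Y (compose (fobj H X') g (fmap H X' X h)) = compose (rcar X') (\<phi> X Y g) h"
    and natr: "\<And>X Y Y' g k. \<lbrakk>X \<in> Ob P; Y \<in> Ob (set_cat U); Y' \<in> Ob (set_cat U);
        g \<in> fobj H X \<rightarrow>\<^sub>E Y; k \<in> Y \<rightarrow>\<^sub>E Y'\<rbrakk> \<Longrightarrow>
      \<phi> X Y' (compose (fobj H X) k g) = compose (rcar X) (fmap G Y Y' k) (\<phi> X Y g)"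
    using left_adjointE[OF adj category_PSh category_set_cat]
    unfolding set_cat_simps(2,4) PSh_simps(3) by blast
  have \<phi>A: "\<phi> X Y g \<in> Arr P X (fobj G Y)"
    if "X \<in> Ob P" "Y \<in> Ob (set_cat U)" "g \<in> fobj H X \<rightarrow>\<^sub>E Y" for X Y g
    using bij[OF that(1,2)] that(3) unfolding bij_betw_def by blast
  \<comment> \<open>The only candidate for the composite
    \<open>H M \<rightarrow> F M \<rightarrow> F X\<close> belonging to \<open>x\<close>: it is
    constant, as \<open>F M\<close> is a singleton.\<close>
  define k where "k X x = (\<lambda>t\<in>fobj H reg. q X x)" for X x
  \<comment> \<open>What the transpose of a component at \<open>X\<close> has to be: precomposed
    with the map \<open>M \<rightarrow> X\<close> given by \<open>x\<close>, it must yield the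
    transpose of \<open>k X x\<close>, and evaluation at \<open>\<one>\<close> then recovers its
    value at \<open>x\<close>.\<close>
  define W where "W X = (\<lambda>x\<in>rcar X. \<phi> reg (fobj F X) (k X x) (code \<one>))" for X
  have k: "k X x \<in> fobj H reg \<rightarrow>\<^sub>E fobj F X" if "X \<in> Ob P" "x \<in> rcar X" for X x
    using that component_functorD(1)[OF F that(1)] unfolding k_def by auto
  have W: "W X \<in> Arr P X (fobj G (fobj F X))" if X: "X \<in> Ob P" for X
    unfolding Arr_PSh_iff
  proof (intro conjI ballI)
    show "W X \<in> rcar X \<rightarrow>\<^sub>E rcar (fobj G (fobj F X))"
      using PSh_ArrD(1)[OF \<phi>A[OF reg_Ob FO[OF X] k[OF X]] one_reg] unfolding W_def by auto
  next
    fix x m assume x: "x \<in> rcar X" and m: "m \<in> carrier M"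
    let ?g = "\<phi> reg (fobj F X) (k X x)"
    have cm: "code m \<in> rcar reg" using m by (simp add: rcar_reg)
    note pm = point_map_Arr[OF reg_Ob cm]
    \<comment> \<open>A constant map absorbs \<open>H\<close> of left multiplication by
      \<open>m\<close>. By naturality the transpose \<open>?g\<close> is invariant under left
      multiplications, so \<open>?g \<one> = ?g m = (?g \<one>) m\<close>. Thus \<open>W X\<close>
      takes values fixed by the action, which gives its equivariance.\<close>
    have "compose (fobj H reg) (k X x) (fmap H reg reg (point_map reg (code m))) = k X x"
      using PiE_mem[OF HA[OF reg_Ob reg_Ob pm]] by (auto simp: compose_def k_def fun_eq_iff)
    then have "?g = compose (rcar reg) ?g (point_map reg (code m))"
      using natl[OF reg_Ob reg_Ob FO[OF X] pm k[OF X x]] by simp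
    then have "?g (code \<one>) = ?g (point_map reg (code m) (code \<one>))"
      using compose_eq[OF one_reg] by metis
    also have "\<dots> = ?g (ract reg (code \<one>) m)"
      using m by (simp add: point_map_code ract_reg)
    also have "\<dots> = ract (fobj G (fobj F X)) (?g (code \<one>)) m"
      using PSh_ArrD(3)[OF \<phi>A[OF reg_Ob FO[OF X] k[OF X x]] one_reg m] .
    finally have "?g (code \<one>) = ract (fobj G (fobj F X)) (?g (code \<one>)) m" .
    moreover have "k X (ract X x m) = k X x"
      using component_functor_act[OF F X x m] by (simp add: k_def)
    ultimately show "W X (ract X x m) = ract (fobj G (fobj F X)) (W X x) m"
      using x Ob_act(1)[OF X x m] by (simp add: W_def)
  qed
  have W_unique: "\<phi> X (fobj F X) (\<alpha> X) = W X" if \<alpha>: "\<alpha> \<in> nat_trans P (set_cat U) H F" and X: "X \<in> Ob P"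
    for \<alpha> X
  proof (rule extensionalityI[of _ "rcar X"])
    have \<alpha>A: "\<alpha> Y \<in> fobj H Y \<rightarrow>\<^sub>E fobj F Y" if "Y \<in> Ob P" for Y
      using \<alpha> that unfolding nat_trans_def set_cat_simps by blast
    have \<alpha>n: "compose (fobj H Y) (\<alpha> Z) (fmap H Y Z f) = compose (fobj H Y) (fmap F Y Z f) (\<alpha> Y)"
      if "Y \<in> Ob P" "Z \<in> Ob P" "f \<in> Arr P Y Z" for Y Z f
      using \<alpha> that unfolding nat_trans_def set_cat_simps by blast
    note \<phi>\<alpha> = \<phi>A[OF X FO[OF X] \<alpha>A[OF X]]
    show "\<phi> X (fobj F X) (\<alpha> X) \<in> extensional (rcar X)" using PSh_ArrD(2)[OF \<phi>\<alpha>] .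
    show "W X \<in> extensional (rcar X)" by (simp add: W_def)
    fix x assume x: "x \<in> rcar X"
    note pm = point_map_Arr[OF X x]
    have "compose (fobj H reg) (fmap F reg X (point_map X x)) (\<alpha> reg) = k X x"
    proof (rule extensionalityI[of _ "fobj H reg"])
      fix t assume t: "t \<in> fobj H reg"
      then have "\<alpha> reg t = q reg (code \<one>)"
        using \<alpha>A[OF reg_Ob] component_functor_reg[OF F] by auto
      then show "compose (fobj H reg) (fmap F reg X (point_map X x)) (\<alpha> reg) t = k X x t"
        using t component_functorD(4)[OF F reg_Ob X pm one_reg] Ob_act(2)[OF X x]
        by (simp add: compose_eq k_def point_map_code)
    qed (simp_all add: compose_def k_def)
    then have "\<phi> reg (fobj F X) (k X x) = compose (rcar reg) (\<phi> X (fobj F X) (\<alpha> X)) (point_map X x)"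
      using \<alpha>n[OF reg_Ob X pm] natl[OF X reg_Ob FO[OF X] pm \<alpha>A[OF X]] by simp
    then have "\<phi> reg (fobj F X) (k X x) (code \<one>) = \<phi> X (fobj F X) (\<alpha> X) (point_map X x (code \<one>))"
      using compose_eq[OF one_reg] by metis
    then show "\<phi> X (fobj F X) (\<alpha> X) x = W X x"
      using x Ob_act(2)[OF X x] by (simp add: W_def point_map_code)
  qed
  define \<alpha> where "\<alpha> = (\<lambda>X\<in>Ob P. inv_into (fobj H X \<rightarrow>\<^sub>E fobj F X) (\<phi> X (fobj F X)) (W X))"
  have \<alpha>A: "\<alpha> X \<in> fobj H X \<rightarrow>\<^sub>E fobj F X" and \<phi>\<alpha>: "\<phi> X (fobj F X) (\<alpha> X) = W X" if X: "X \<in> Ob P" for X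
  proof -
    have "W X \<in> \<phi> X (fobj F X) ` (fobj H X \<rightarrow>\<^sub>E fobj F X)"
      using bij[OF X FO[OF X]] W[OF X] unfolding bij_betw_def by blast
    moreover have "\<alpha> X = inv_into (fobj H X \<rightarrow>\<^sub>E fobj F X) (\<phi> X (fobj F X)) (W X)"
      using X unfolding \<alpha>_def by (rule restrict_apply')
    ultimately show "\<alpha> X \<in> fobj H X \<rightarrow>\<^sub>E fobj F X" "\<phi> X (fobj F X) (\<alpha> X) = W X"
      by (metis inv_into_into, metis f_inv_into_f)
  qed
  have nat: "compose (fobj H X) (\<alpha> Y) (fmap H X Y f) = compose (fobj H X) (fmap F X Y f) (\<alpha> X)"
    if X: "X \<in> Ob P" and Y: "Y \<in> Ob P" and f: "f \<in> Arr P X Y" for X Y f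
  proof -
    note Ff = FA[OF X Y f]
    \<comment> \<open>Naturality is verified on transposes, where it becomes compatibility of
      \<open>W\<close> with \<open>f\<close>; injectivity of transposition brings it back.\<close>
    have "compose (rcar X) (W Y) f = compose (rcar X) (fmap G (fobj F X) (fobj F Y) (fmap F X Y f)) (W X)"
    proof (rule extensionalityI[of _ "rcar X"])
      fix x assume x: "x \<in> rcar X"
      have fx: "f x \<in> rcar Y" using PSh_ArrD(1)[OF f x] .
      have "compose (fobj H reg) (fmap F X Y f) (k X x) = k Y (f x)"
        using component_functorD(4)[OF F X Y f x] by (auto simp: compose_def k_def fun_eq_iff)
      then have "\<phi> reg (fobj F Y) (k Y (f x)) = compose (rcar reg)
          (fmap G (fobj F X) (fobj F Y) (fmap F X Y f)) (\<phi> reg (fobj F X) (k X x))"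
        using natr[OF reg_Ob FO[OF X] FO[OF Y] k[OF X x] Ff] by simp
      then have "\<phi> reg (fobj F Y) (k Y (f x)) (code \<one>) =
          fmap G (fobj F X) (fobj F Y) (fmap F X Y f) (\<phi> reg (fobj F X) (k X x) (code \<one>))"
        using compose_eq[OF one_reg] by metis
      then show "compose (rcar X) (W Y) f x =
          compose (rcar X) (fmap G (fobj F X) (fobj F Y) (fmap F X Y f)) (W X) x"
        using x fx by (simp add: compose_eq W_def)
    qed (simp_all add: compose_def)
    then have "\<phi> X (fobj F Y) (compose (fobj H X) (\<alpha> Y) (fmap H X Y f)) =
        \<phi> X (fobj F Y) (compose (fobj H X) (fmap F X Y f) (\<alpha> X))"
      using natl[OF Y X FO[OF Y] f \<alpha>A[OF Y]] natr[OF X FO[OF X] FO[OF Y] \<alpha>A[OF X] Ff]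
        \<phi>\<alpha>[OF X] \<phi>\<alpha>[OF Y] by simp
    moreover have "compose (fobj H X) (\<alpha> Y) (fmap H X Y f) \<in> fobj H X \<rightarrow>\<^sub>E fobj F Y"
      using HA[OF X Y f] \<alpha>A[OF Y] by (auto simp: compose_def)
    moreover have "compose (fobj H X) (fmap F X Y f) (\<alpha> X) \<in> fobj H X \<rightarrow>\<^sub>E fobj F Y"
      using Ff \<alpha>A[OF X] by (auto simp: compose_def)
    ultimately show ?thesis using bij[OF X FO[OF Y]] unfolding bij_betw_def inj_on_def by blast
  qed
  show ?thesis
  proof (rule ex1I[of _ \<alpha>])
    show "\<alpha> \<in> nat_trans P (set_cat U) H F"
      unfolding nat_trans_def set_cat_simps using \<alpha>A nat by (auto simp: \<alpha>_def simp del: PSh_simps)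
    fix \<beta> assume \<beta>: "\<beta> \<in> nat_trans P (set_cat U) H F"
    show "\<beta> = \<alpha>"
    proof (rule extensionalityI[of _ "Ob P"])
      show "\<beta> \<in> extensional (Ob P)" using \<beta> unfolding nat_trans_def by blast
      show "\<alpha> \<in> extensional (Ob P)" by (simp add: \<alpha>_def)
      fix X assume X: "X \<in> Ob P"
      have "\<beta> X \<in> fobj H X \<rightarrow>\<^sub>E fobj F X" using \<beta> X unfolding nat_trans_def set_cat_simps by blast
      moreover have "\<phi> X (fobj F X) (\<beta> X) = \<phi> X (fobj F X) (\<alpha> X)" using W_unique[OF \<beta> X] \<phi>\<alpha>[OF X] by simp
      ultimately show "\<beta> X = \<alpha> X"
        using bij[OF X FO[OF X]] \<alpha>A[OF X] unfolding bij_betw_def inj_on_def by blast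
    qed
  qed
qed

text \<open>There is at most one map out of an empty carrier, so by adjunction at most one map from
  \<open>H X\<close> to a two-element set. An element of \<open>H X\<close> would give two constant
  maps.\<close>

lemma left_adjoint_empty:
  fixes H :: "(('u, 'm) rset, 'u \<Rightarrow> 'u, 'u set, 'u \<Rightarrow> 'u) ftor"
  assumes adj: "left_adjoint P (set_cat U) H G" and X: "X \<in> Ob P" and empty: "rcar X = {}"
  shows "fobj H X = {}"
proof (rule ccontr)
  assume "fobj H X \<noteq> {}"
  then obtain t where t: "t \<in> fobj H X" by blast
  have "infinite (UNIV :: 'u set)" using universe unfolding set_universe_def by blast
  then have "UNIV \<noteq> {undefined :: 'u}" by (metis finite.emptyI finite.insertI)
  then obtain a b :: 'u where ab: "a \<noteq> b" by blast
  let ?Y = "{a, b}"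
  have Y: "?Y \<in> Ob (set_cat U)"
    using universe unfolding set_cat_simps(1) is_small_iff[OF universe] set_universe_def by simp
  obtain \<phi> where bij: "bij_betw (\<phi> X ?Y) (fobj H X \<rightarrow>\<^sub>E ?Y) (Arr P X (fobj G ?Y))"
    using left_adjointE[OF adj category_PSh category_set_cat] X Y unfolding set_cat_simps(2) by metis
  let ?g = "\<lambda>t\<in>fobj H X. a" and ?h = "\<lambda>t\<in>fobj H X. b"
  have gh: "?g \<in> fobj H X \<rightarrow>\<^sub>E ?Y" "?h \<in> fobj H X \<rightarrow>\<^sub>E ?Y" by auto
  then have "\<phi> X ?Y ?g \<in> Arr P X (fobj G ?Y)" "\<phi> X ?Y ?h \<in> Arr P X (fobj G ?Y)"
    using bij unfolding bij_betw_def by blast+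
  then have "\<phi> X ?Y ?g = \<phi> X ?Y ?h"
    unfolding Arr_PSh_iff empty by auto
  then have "?g = ?h" using bij gh unfolding bij_betw_def inj_on_def by blast
  then show False using t ab by (metis restrict_apply')
qed

section \<open>The forgetful functor as a point\<close>

definition underlying :: "(('u, 'm) rset, 'u \<Rightarrow> 'u, 'u set, 'u \<Rightarrow> 'u) ftor" where
  "underlying = \<lparr> fobj = rcar, fmap = (\<lambda>X Y f. f) \<rparr>"

lemma underlying_is_functor: "is_functor P (set_cat U) underlying"
  unfolding is_functor_def underlying_def by (auto simp: Arr_PSh_iff)

lemma underlying_preserves_finite_limits: "preserves_finite_limits P (set_cat U) underlying"
  unfolding preserves_finite_limits_def
proof (intro allI impI, elim conjE)
  fix J :: "(nat, nat) cat" and E L p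
  assume E: "is_functor J P E" and L: "is_limit J P E L p"
  then have cone: "is_cone J P E L p" unfolding is_limit_def by blast
  show "is_limit J (set_cat U) (comp_functor underlying E) (fobj underlying L)
      (\<lambda>i. fmap underlying L (fobj E i) (p i))"
  proof (rule set_limitI)
    show "is_cone J (set_cat U) (comp_functor underlying E) (fobj underlying L)
        (\<lambda>i. fmap underlying L (fobj E i) (p i))"
      using cone_image[OF underlying_is_functor E cone] .
  next
    fix x
    assume "\<And>i. i \<in> Ob J \<Longrightarrow> x i \<in> fobj (comp_functor underlying E) i"
      and "\<And>i j a. \<lbrakk>i \<in> Ob J; j \<in> Ob J; a \<in> Arr J i j\<rbrakk> \<Longrightarrow>
        fmap (comp_functor underlying E) i j a (x i) = x j"
    then show "\<exists>!l. l \<in> fobj underlying L \<and> (\<forall>i\<in>Ob J. fmap underlying L (fobj E i) (p i) l = x i)"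
      using limit_elements[OF E L, of x] unfolding comp_functor_def underlying_def by simp
  qed
qed

definition fun_code :: "'u set \<Rightarrow> ('m \<Rightarrow> 'u) \<Rightarrow> 'u" where
  "fun_code S = encode U (carrier M \<rightarrow>\<^sub>E S)"

definition fun_decode :: "'u set \<Rightarrow> 'u \<Rightarrow> 'm \<Rightarrow> 'u" where
  "fun_decode S = the_inv_into (carrier M \<rightarrow>\<^sub>E S) (fun_code S)"

text \<open>The coinduced right \<open>M\<close>-set on \<open>S\<close>. Shifting the argument on
  the left gives a right action: \<open>(f m) n\<close> and \<open>f (m n)\<close> both send
  \<open>k\<close> to \<open>f (m n k)\<close>.\<close>

definition cofree :: "('u set, 'u \<Rightarrow> 'u, ('u, 'm) rset, 'u \<Rightarrow> 'u) ftor" where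
  "cofree = \<lparr>
     fobj = (\<lambda>S. encode_rset U
       \<lparr> rcar = carrier M \<rightarrow>\<^sub>E S, ract = (\<lambda>f m. \<lambda>n\<in>carrier M. f (m \<otimes> n)) \<rparr>),
     fmap = (\<lambda>S T g. \<lambda>z\<in>fun_code S ` (carrier M \<rightarrow>\<^sub>E S).
       fun_code T (compose (carrier M) g (fun_decode S z))) \<rparr>"

lemma small_functions: "is_small U S \<Longrightarrow> is_small U (carrier M \<rightarrow>\<^sub>E (S :: 'u set))"
  using universe unfolding is_small_iff[OF universe] set_universe_def by blast

lemma inj_fun_code: "is_small U S \<Longrightarrow> inj_on (fun_code S) (carrier M \<rightarrow>\<^sub>E S)"
  unfolding fun_code_def using encode(1) small_functions by blast

lemma fun_decode_code: "is_small U S \<Longrightarrow> f \<in> carrier M \<rightarrow>\<^sub>E S \<Longrightarrow> fun_decode S (fun_code S f) = f"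
  unfolding fun_decode_def by (rule the_inv_into_f_f[OF inj_fun_code])

lemma rcar_cofree: "rcar (fobj cofree S) = fun_code S ` (carrier M \<rightarrow>\<^sub>E S)"
  unfolding cofree_def fun_code_def by (simp add: rcar_encode_rset)

lemma shift_mem: "f \<in> carrier M \<rightarrow>\<^sub>E S \<Longrightarrow> m \<in> carrier M \<Longrightarrow>
    (\<lambda>n\<in>carrier M. f (m \<otimes> n)) \<in> carrier M \<rightarrow>\<^sub>E S"
  by auto

lemma ract_cofree:
  assumes "is_small U S" "f \<in> carrier M \<rightarrow>\<^sub>E S"
  shows "ract (fobj cofree S) (fun_code S f) m = fun_code S (\<lambda>n\<in>carrier M. f (m \<otimes> n))"
  using ract_encode_rset[of U "\<lparr> rcar = carrier M \<rightarrow>\<^sub>E S, ract = (\<lambda>f m. \<lambda>n\<in>carrier M. f (m \<otimes> n)) \<rparr>" f m]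
    small_functions assms
  unfolding cofree_def fun_code_def by simp

lemma cofree_Ob:
  assumes "is_small U S"
  shows "fobj cofree S \<in> Ob P"
proof -
  have "right_mset M \<lparr> rcar = carrier M \<rightarrow>\<^sub>E S, ract = (\<lambda>f m. \<lambda>n\<in>carrier M. f (m \<otimes> n)) \<rparr>"
    unfolding right_mset_def by (auto simp: fun_eq_iff PiE_def extensional_def m_assoc)
  then show ?thesis
    unfolding cofree_def ftor.simps
    by (rule encode_rset_Ob) (simp_all add: small_functions assms universe)
qed

lemma fmap_cofree:
  assumes "is_small U S" "f \<in> carrier M \<rightarrow>\<^sub>E S"
  shows "fmap cofree S T g (fun_code S f) = fun_code T (compose (carrier M) g f)"
  using assms fun_decode_code[OF assms] unfolding cofree_def by simp

lemma compose_PiE: "f \<in> X \<rightarrow>\<^sub>E Y \<Longrightarrow> g \<in> Y \<rightarrow>\<^sub>E Z \<Longrightarrow> compose X g f \<in> X \<rightarrow>\<^sub>E Z"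
  by (auto simp: compose_def)

lemma fmap_cofree_Arr:
  assumes S: "is_small U S" and g: "g \<in> S \<rightarrow>\<^sub>E T" and T: "is_small U T"
  shows "fmap cofree S T g \<in> Arr P (fobj cofree S) (fobj cofree T)"
  unfolding Arr_PSh_iff rcar_cofree
proof (intro conjI ballI)
  show "fmap cofree S T g \<in> fun_code S ` (carrier M \<rightarrow>\<^sub>E S) \<rightarrow>\<^sub>E fun_code T ` (carrier M \<rightarrow>\<^sub>E T)"
  proof (rule PiE_I)
    fix z assume "z \<in> fun_code S ` (carrier M \<rightarrow>\<^sub>E S)"
    then obtain f where f: "f \<in> carrier M \<rightarrow>\<^sub>E S" "z = fun_code S f" by blast
    show "fmap cofree S T g z \<in> fun_code T ` (carrier M \<rightarrow>\<^sub>E T)"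
      unfolding f(2) fmap_cofree[OF S f(1)] by (rule imageI) (rule compose_PiE[OF f(1) g])
  qed (simp add: cofree_def)
next
  fix z m assume "z \<in> fun_code S ` (carrier M \<rightarrow>\<^sub>E S)" and m: "m \<in> carrier M"
  then obtain f where f: "f \<in> carrier M \<rightarrow>\<^sub>E S" "z = fun_code S f" by blast
  have "compose (carrier M) g (\<lambda>n\<in>carrier M. f (m \<otimes> n)) =
      (\<lambda>n\<in>carrier M. compose (carrier M) g f (m \<otimes> n))"
    using m by (auto simp: compose_def fun_eq_iff)
  then show "fmap cofree S T g (ract (fobj cofree S) z m) =
      ract (fobj cofree T) (fmap cofree S T g z) m"
    using f m fmap_cofree[OF S f(1)] fmap_cofree[OF S shift_mem[OF f(1) m]] ract_cofree[OF S f(1)]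
      ract_cofree[OF T compose_PiE[OF f(1) g]] by simp
qed

lemma cofree_is_functor: "is_functor (set_cat U) P cofree"
  unfolding is_functor_def
proof (intro conjI ballI)
  fix S :: "'u set" assume "S \<in> Ob (set_cat U)"
  then have S: "is_small U S" by simp
  show "fobj cofree S \<in> Ob P" using cofree_Ob[OF S] .
  show "fmap cofree S S (Idt (set_cat U) S) = Idt P (fobj cofree S)"
  proof (rule extensionalityI[of _ "rcar (fobj cofree S)"])
    fix z assume z: "z \<in> rcar (fobj cofree S)"
    then obtain f where f: "f \<in> carrier M \<rightarrow>\<^sub>E S" "z = fun_code S f" unfolding rcar_cofree by blast
    then show "fmap cofree S S (Idt (set_cat U) S) z = Idt P (fobj cofree S) z"
      using fmap_cofree[OF S f(1)] compose_restrict_id(2)[OF f(1)] z by simp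
  qed (simp_all add: cofree_def rcar_encode_rset fun_code_def)
  fix T g assume "T \<in> Ob (set_cat U)" and g: "g \<in> Arr (set_cat U) S T"
  then have T: "is_small U T" by simp
  then show g': "fmap cofree S T g \<in> Arr P (fobj cofree S) (fobj cofree T)"
    using fmap_cofree_Arr[OF S] g by simp
  fix V h assume "V \<in> Ob (set_cat U)" and h: "h \<in> Arr (set_cat U) T V"
  then have V: "is_small U V" by simp
  show "fmap cofree S V (Comp (set_cat U) S T V h g) =
      Comp P (fobj cofree S) (fobj cofree T) (fobj cofree V) (fmap cofree T V h) (fmap cofree S T g)"
  proof (rule extensionalityI[of _ "rcar (fobj cofree S)"])
    fix z assume z: "z \<in> rcar (fobj cofree S)"
    then obtain f where f: "f \<in> carrier M \<rightarrow>\<^sub>E S" "z = fun_code S f" unfolding rcar_cofree by blast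
    have g2: "g \<in> S \<rightarrow>\<^sub>E T" using g by simp
    have "compose (carrier M) (compose S h g) f = compose (carrier M) h (compose (carrier M) g f)"
      using f(1) by (auto simp: compose_def fun_eq_iff)
    then show "fmap cofree S V (Comp (set_cat U) S T V h g) z =
        Comp P (fobj cofree S) (fobj cofree T) (fobj cofree V) (fmap cofree T V h) (fmap cofree S T g) z"
      using z f(2) fmap_cofree[OF S f(1)] fmap_cofree[OF T compose_PiE[OF f(1) g2]]
      by (simp add: compose_eq)
  qed (simp_all add: cofree_def rcar_encode_rset fun_code_def compose_def)
qed

text \<open>A map \<open>g\<close> on elements corresponds to the equivariant map sending
  \<open>x\<close> to the record of \<open>g\<close> along its orbit,
  \<open>n \<mapsto> g (x n)\<close>.\<close>

lemma underlying_left_adjoint: "left_adjoint P (set_cat U) underlying cofree"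
proof -
  define \<phi> where "\<phi> X S g = (\<lambda>x\<in>rcar X. fun_code S (\<lambda>n\<in>carrier M. g (ract X x n)))"
    for X :: "('u, 'm) rset" and S :: "'u set" and g :: "'u \<Rightarrow> 'u"
  have orb: "(\<lambda>n\<in>carrier M. g (ract X x n)) \<in> carrier M \<rightarrow>\<^sub>E S"
    if "X \<in> Ob P" "g \<in> rcar X \<rightarrow>\<^sub>E S" "x \<in> rcar X" for X S g x
    using Ob_act(1)[OF that(1,3)] that(2) by auto
  have bij: "bij_betw (\<phi> X S) (rcar X \<rightarrow>\<^sub>E S) (Arr P X (fobj cofree S))"
    if X: "X \<in> Ob P" and S: "is_small U S" for X S
    unfolding bij_betw_def
  proof (intro conjI inj_onI equalityI subsetI)
    fix g g' assume g: "g \<in> rcar X \<rightarrow>\<^sub>E S" and g': "g' \<in> rcar X \<rightarrow>\<^sub>E S" and eq: "\<phi> X S g = \<phi> X S g'"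
    show "g = g'"
    proof (rule PiE_ext[OF g g'])
      fix x assume x: "x \<in> rcar X"
      then have "fun_code S (\<lambda>n\<in>carrier M. g (ract X x n)) = fun_code S (\<lambda>n\<in>carrier M. g' (ract X x n))"
        using fun_cong[OF eq, of x] by (simp add: \<phi>_def)
      then have "(\<lambda>n\<in>carrier M. g (ract X x n)) = (\<lambda>n\<in>carrier M. g' (ract X x n))"
        using inj_onD[OF inj_fun_code[OF S]] orb[OF X g x] orb[OF X g' x] by blast
      from fun_cong[OF this, of \<one>] show "g x = g' x" using Ob_act(2)[OF X x] by simp
    qed
  next
    fix h assume "h \<in> \<phi> X S ` (rcar X \<rightarrow>\<^sub>E S)"
    then obtain g where g: "g \<in> rcar X \<rightarrow>\<^sub>E S" "h = \<phi> X S g" by blast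
    show "h \<in> Arr P X (fobj cofree S)"
      unfolding Arr_PSh_iff rcar_cofree
    proof (intro conjI ballI)
      show "h \<in> rcar X \<rightarrow>\<^sub>E fun_code S ` (carrier M \<rightarrow>\<^sub>E S)"
        using orb[OF X g(1)] unfolding g(2) \<phi>_def by (intro PiE_I) auto
      fix x m assume x: "x \<in> rcar X" and m: "m \<in> carrier M"
      have "(\<lambda>n\<in>carrier M. (\<lambda>n\<in>carrier M. g (ract X x n)) (m \<otimes> n)) =
          (\<lambda>n\<in>carrier M. g (ract X (ract X x m) n))"
        using Ob_act(3)[OF X x m] m by (auto simp: fun_eq_iff)
      then show "h (ract X x m) = ract (fobj cofree S) (h x) m"
        using x m ract_cofree[OF S orb[OF X g(1) x], of m] Ob_act(1)[OF X x m] by (simp add: g(2) \<phi>_def)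
    qed
  next
    fix h assume h: "h \<in> Arr P X (fobj cofree S)"
    \<comment> \<open>Transposing back is evaluation at \<open>\<one>\<close>: by equivariance
      \<open>h x\<close> at \<open>n\<close> equals \<open>h (x n)\<close> at \<open>\<one>\<close>,
      so these values determine \<open>h\<close>.\<close>
    let ?g = "\<lambda>x\<in>rcar X. fun_decode S (h x) \<one>"
    have hx: "\<exists>f. f \<in> carrier M \<rightarrow>\<^sub>E S \<and> h x = fun_code S f" if "x \<in> rcar X" for x
      using PSh_ArrD(1)[OF h that] unfolding rcar_cofree by blast
    have "?g \<in> rcar X \<rightarrow>\<^sub>E S"
    proof (rule PiE_I)
      fix x assume x: "x \<in> rcar X"
      obtain f where "f \<in> carrier M \<rightarrow>\<^sub>E S" "h x = fun_code S f" using hx[OF x] by blast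
      then show "?g x \<in> S" using x fun_decode_code[OF S] by auto
    qed simp
    moreover have "h = \<phi> X S ?g"
    proof (rule extensionalityI[of _ "rcar X"])
      show "h \<in> extensional (rcar X)" using PSh_ArrD(2)[OF h] .
      show "\<phi> X S ?g \<in> extensional (rcar X)" by (simp add: \<phi>_def)
      fix x assume x: "x \<in> rcar X"
      obtain f where f: "f \<in> carrier M \<rightarrow>\<^sub>E S" "h x = fun_code S f" using hx[OF x] by blast
      have "?g (ract X x n) = f n" if n: "n \<in> carrier M" for n
        using PSh_ArrD(3)[OF h x n] Ob_act(1)[OF X x n] f(2) ract_cofree[OF S f(1)]
          fun_decode_code[OF S shift_mem[OF f(1) n]] n by simp
      then have "(\<lambda>n\<in>carrier M. ?g (ract X x n)) = f"
        using f(1) by (auto simp: fun_eq_iff PiE_def extensional_def)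
      then show "h x = \<phi> X S ?g x" using f(2) x unfolding \<phi>_def by simp
    qed
    ultimately show "h \<in> \<phi> X S ` (rcar X \<rightarrow>\<^sub>E S)" by blast
  qed
  have nat: "\<phi> X' T (compose (rcar X') k (compose (rcar X') g h)) =
      compose (rcar X') (fmap cofree S T k) (compose (rcar X') (\<phi> X S g) h)"
    if X: "X \<in> Ob P" and X': "X' \<in> Ob P" and S: "is_small U S" and h: "h \<in> Arr P X' X"
      and g: "g \<in> rcar X \<rightarrow>\<^sub>E S" for X X' S T h g k
  proof (rule extensionalityI[of _ "rcar X'"])
    fix x assume x: "x \<in> rcar X'"
    have hx: "h x \<in> rcar X" using PSh_ArrD(1)[OF h x] .
    have "(\<lambda>n\<in>carrier M. compose (rcar X') k (compose (rcar X') g h) (ract X' x n)) =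
        compose (carrier M) k (\<lambda>n\<in>carrier M. g (ract X (h x) n))"
      using Ob_act(1)[OF X' x] PSh_ArrD(3)[OF h x] by (auto simp: fun_eq_iff compose_def)
    then show "\<phi> X' T (compose (rcar X') k (compose (rcar X') g h)) x =
        compose (rcar X') (fmap cofree S T k) (compose (rcar X') (\<phi> X S g) h) x"
      using x hx fmap_cofree[OF S orb[OF X g hx]] by (simp add: \<phi>_def compose_eq)
  qed (simp_all add: \<phi>_def compose_def)
  show ?thesis
    unfolding left_adjoint_def
  proof (intro conjI exI[of _ \<phi>] ballI)
    show "bij_betw (\<phi> X S) (Arr (set_cat U) (fobj underlying X) S) (Arr P X (fobj cofree S))"
      if "X \<in> Ob P" "S \<in> Ob (set_cat U)" for X S
      using bij[OF that(1)] that(2) by (simp add: underlying_def)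
    show "\<phi> X' T (Comp (set_cat U) (fobj underlying X') S T k
        (Comp (set_cat U) (fobj underlying X') (fobj underlying X) S g (fmap underlying X' X h))) =
      Comp P X' (fobj cofree S) (fobj cofree T) (fmap cofree S T k)
        (Comp P X' X (fobj cofree S) (\<phi> X S g) h)"
      if "X \<in> Ob P" "X' \<in> Ob P" "S \<in> Ob (set_cat U)" "h \<in> Arr P X' X"
        "g \<in> Arr (set_cat U) (fobj underlying X) S" for X X' S T h g k
      using nat[OF that(1,2) _ that(4)] that(3,5) by (simp add: underlying_def)
  qed (fact underlying_is_functor cofree_is_functor)+
qed

section \<open>Terminal points\<close>

lemma points_simps [simp]:
  "h \<in> Ob (points U M) \<longleftrightarrow> left_adjoint P (set_cat U) (inverse_image h) (direct_image h) \<and>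
     preserves_finite_limits P (set_cat U) (inverse_image h)"
  "Arr (points U M) h k = nat_trans P (set_cat U) (inverse_image h) (inverse_image k)"
  unfolding points_def is_geometric_morphism_def by simp_all

text \<open>The Yoneda lemma: the forgetful functor is represented by \<open>M\<close>.\<close>

lemma nat_trans_underlying:
  assumes H: "is_functor P (set_cat U) H" and t: "t \<in> fobj H reg"
  shows "\<exists>\<alpha>\<in>nat_trans P (set_cat U) underlying H. \<alpha> reg (code \<one>) = t"
proof
  let ?\<alpha> = "\<lambda>X\<in>Ob P. \<lambda>x\<in>rcar X. fmap H reg X (point_map X x) t"
  have HA: "fmap H X Y f \<in> fobj H X \<rightarrow>\<^sub>E fobj H Y"
    if "X \<in> Ob P" "Y \<in> Ob P" "f \<in> Arr P X Y" for X Y f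
    using functor_Arr[OF H that] by simp
  have nat: "fmap H reg Y (point_map Y (f x)) t = fmap H X Y f (fmap H reg X (point_map X x) t)"
    if "X \<in> Ob P" "Y \<in> Ob P" "f \<in> Arr P X Y" "x \<in> rcar X" for X Y f x
    using functor_Comp[OF H reg_Ob that(1,2) point_map_Arr[OF that(1,4)] that(3)]
      compose_point_map[OF that] compose_eq[OF t] by simp
  show "?\<alpha> \<in> nat_trans P (set_cat U) underlying H"
    unfolding nat_trans_def
  proof (intro CollectI conjI ballI)
    show "?\<alpha> \<in> extensional (Ob P)" by (rule restrict_extensional)
    fix X assume X: "X \<in> Ob P"
    show "?\<alpha> X \<in> Arr (set_cat U) (fobj underlying X) (fobj H X)"
      using X PiE_mem[OF HA[OF reg_Ob X point_map_Arr[OF X]] t]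
      by (auto simp: underlying_def simp del: PSh_simps)
    fix Y f assume Y: "Y \<in> Ob P" and f: "f \<in> Arr P X Y"
    show "Comp (set_cat U) (fobj underlying X) (fobj underlying Y) (fobj H Y) (?\<alpha> Y)
        (fmap underlying X Y f) =
      Comp (set_cat U) (fobj underlying X) (fobj H X) (fobj H Y) (fmap H X Y f) (?\<alpha> X)"
      using X Y nat[OF X Y f] PSh_ArrD(1)[OF f]
      by (auto simp: underlying_def compose_def fun_eq_iff simp del: PSh_simps)
  qed
  have "point_map reg (code \<one>) = Idt P reg"
    by (rule Arr_reg_eqI[OF point_map_Arr[OF reg_Ob one_reg] cat_Idt[OF category_PSh reg_Ob]])
       (simp add: point_map_code one_reg ract_reg)
  then show "?\<alpha> reg (code \<one>) = t"
    using reg_Ob one_reg functor_Idt[OF H reg_Ob] t by (simp del: PSh_simps(1))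
qed

lemma has_terminal_point_iff: "has_terminal_object (points U M) \<longleftrightarrow> right_collapsible M"
proof
  assume rc: "right_collapsible M"
  let ?T = "\<lparr> inverse_image = component_reps, direct_image = trivial_action \<rparr>"
  have "?T \<in> Ob (points U M)"
    using component_functor_left_adjoint[OF component_reps_component_functor]
      component_functor_preserves_finite_limits[OF component_reps_component_functor rc] by simp
  moreover have "\<exists>!f. f \<in> Arr (points U M) h ?T" if "h \<in> Ob (points U M)" for h
  proof -
    have "left_adjoint P (set_cat U) (inverse_image h) (direct_image h)" using that by simp
    from unique_nat_trans_component_functor[OF this component_reps_component_functor]
    show ?thesis by simp
  qed
  ultimately show "has_terminal_object (points U M)" unfolding has_terminal_object_def by blast
next
  assume "has_terminal_object (points U M)"
  then obtain T where T: "T \<in> Ob (points U M)"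
    and uniq: "\<And>h. h \<in> Ob (points U M) \<Longrightarrow> \<exists>!f. f \<in> Arr (points U M) h T"
    unfolding has_terminal_object_def by blast
  let ?H = "inverse_image T"
  have adj: "left_adjoint P (set_cat U) ?H (direct_image T)"
    and lim: "preserves_finite_limits P (set_cat U) ?H" using T by simp_all
  have H: "is_functor P (set_cat U) ?H" using adj unfolding left_adjoint_def by blast
  have "\<lparr> inverse_image = underlying, direct_image = cofree \<rparr> \<in> Ob (points U M)"
    using underlying_left_adjoint underlying_preserves_finite_limits by simp
  from uniq[OF this] obtain \<alpha> where \<alpha>: "\<alpha> \<in> nat_trans P (set_cat U) underlying ?H"
    and \<alpha>_uniq: "\<And>\<beta>. \<beta> \<in> nat_trans P (set_cat U) underlying ?H \<Longrightarrow> \<beta> = \<alpha>" by auto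
  have "\<alpha> reg \<in> rcar reg \<rightarrow>\<^sub>E fobj ?H reg"
    using \<alpha> reg_Ob unfolding nat_trans_def underlying_def by (simp del: PSh_simps(1))
  then have "\<alpha> reg (code \<one>) \<in> fobj ?H reg" using one_reg by blast
  \<comment> \<open>By Yoneda every \<open>t\<close> is the value at \<open>code \<one>\<close> of
    some transformation from the forgetful functor, and terminality of \<open>T\<close> allows only
    one such transformation.\<close>
  moreover have "t = \<alpha> reg (code \<one>)" if "t \<in> fobj ?H reg" for t
    using nat_trans_underlying[OF H that] \<alpha>_uniq by blast
  ultimately have "fobj ?H reg = {\<alpha> reg (code \<one>)}" by blast
  then show "right_collapsible M"
    using collapsible_if_preserves_equalizers[OF H
        preserves_equalizers_if_finite_limits[OF category_PSh category_set_cat H lim]]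
      left_adjoint_empty[OF adj] by blast
qed

end

theorem theorem2p48:
  fixes M :: "('m, 'e) monoid_scheme" and U :: "'u set \<Rightarrow> bool"
  assumes "monoid M" and "set_universe M U"
  shows
    "(preserves_finite_limits (PSh U M) (set_cat U) (components M) \<longleftrightarrow> totally_connected U M) \<and>
     (preserves_finite_limits (PSh U M) (set_cat U) (components M) \<longleftrightarrow>
        flat_lset U M terminal_lset) \<and>
     (preserves_finite_limits (PSh U M) (set_cat U) (components M) \<longleftrightarrow>
        cofiltered (monoid_cat M)) \<and>
     (preserves_finite_limits (PSh U M) (set_cat U) (components M) \<longleftrightarrow>
        right_collapsible M) \<and>
     (preserves_finite_limits (PSh U M) (set_cat U) (components M) \<longleftrightarrow>
        preserves_pullbacks (PSh U M) (set_cat U) (components M)) \<and>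
     (preserves_finite_limits (PSh U M) (set_cat U) (components M) \<longleftrightarrow>
        preserves_equalizers (PSh U M) (set_cat U) (components M)) \<and>
     (preserves_finite_limits (PSh U M) (set_cat U) (components M) \<longleftrightarrow>
        has_terminal_object (points U M))"
proof -
  interpret small_monoid M U
    by (intro small_monoid.intro small_monoid_axioms.intro assms)
  have "left_mset M terminal_lset"
    unfolding left_mset_def terminal_lset_def by simp
  then have "flat_lset U M terminal_lset \<longleftrightarrow> right_collapsible M"
    unfolding flat_lset_def
    using component_functor_limits_iff(1)[OF tensor_terminal_component_functor] by blast
  then show ?thesis
    unfolding totally_connected_def
    using component_functor_limits_iff[OF components_component_functor] cofiltered_monoid_cat_iff
      has_terminal_point_iff by blast
qed

end
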